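(* Let $N\ge1$ be the space dimension, $m\ge0$, $R>0$ and $p>1$. Let $f,g\in \mathcal{C}_0^\infty(\mathbb{R}^N)$ be non-negative functions which are compactly supported on the ball $B_{\mathbb{R}^N}(0,R)$ and do not vanish everywhere. Let $u$ be an energy solution on $[0,T_\varepsilon)$ of $$u_{tt}-t^{2m}\Delta u=|u_t|^p \ \text{ in } \mathbb{R}^N\times[0,\infty),\qquad u(x,0)=\varepsilon f(x),\quad u_t(x,0)=\varepsilon g(x),\quad x\in\mathbb{R}^N,$$ which satisfies $\operatorname{supp}(u)\subset\{(x,t)\in\mathbb{R}^N\times[0,\infty): |x|\le \xi(t)+R\}$, where $\xi(t)=\frac{t^{m+1}}{m+1}$. Then there exists a constant $\varepsilon_0=\varepsilon_0(f,g,N,R,p,m)>0$ such that $T_\varepsilon$ verifies $$T_\varepsilon\le\begin{cases} C\,\varepsilon^{-\frac{2(p-1)}{2-((m+1)(N-1)-m)(p-1)}} & \text{for } 1<p<p_{tr}(N,m),\\[4pt] \exp\left(C\varepsilon^{-(p-1)}\right) & \text{for } p=p_{tr}(N,m)=1+\frac{2}{(m+1)(N-1)-m},\end{cases}$$ where $C$ is a positive constant independent of $\varepsilon$ and $0<\varepsilon\le\varepsilon_0$.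
   Context: The exponent is $p_{tr}(N,m):=1+\frac{2}{(m+1)(N-1)-m}$. Energy solution. Let $f,g\in \mathcal{C}_0^\infty(\mathbb{R}^N)$. A function $u$ is an energy solution on $[0,T)$ of the Cauchy problem $$u_{tt}-t^{2m}\Delta u=|u_t|^p \ \text{ in } \mathbb{R}^N\times[0,\infty),\qquad u(x,0)=\varepsilon f(x),\quad u_t(x,0)=\varepsilon g(x),\quad x\in\mathbb{R}^N,$$ if it takes these initial data, $$u\in \mathcal{C}([0,T),H^1(\mathbb{R}^N))\cap \mathcal{C}^1([0,T),L^2(\mathbb{R}^N)),\quad u_t\in L^p_{loc}((0,T)\times\mathbb{R}^N),$$ and for all $\Phi\in \mathcal{C}_0^\infty(\mathbb{R}^N\times[0,T))$ and all $t\in[0,T)$, $$\int_{\mathbb{R}^N}u_t(x,t)\Phi(x,t)\,dx-\int_{\mathbb{R}^N}u_t(x,0)\Phi(x,0)\,dx-\int_0^t\int_{\mathbb{R}^N}u_t(x,s)\Phi_t(x,s)\,dx\,ds+\int_0^t s^{2m}\int_{\mathbb{R}^N}\nabla u(x,s)\cdot\nabla\Phi(x,s)\,dx\,ds$$ $$=\int_0^t\int_{\mathbb{R}^N}|u_t(x,s)|^p\,\Phi(x,s)\,dx\,ds.$$ *)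

theory Defs
  imports "HOL-Analysis.Analysis"
begin

section \<open>Smooth functions with compact support\<close>

primrec C_k :: "nat \<Rightarrow> ('a::real_normed_vector \<Rightarrow> 'b::real_normed_vector) \<Rightarrow> bool" where
  "C_k 0 f \<longleftrightarrow> continuous_on UNIV f"
| "C_k (Suc k) f \<longleftrightarrow>
     (\<forall>x. f differentiable (at x)) \<and> (\<forall>h. C_k k (\<lambda>x. frechet_derivative f (at x) h))"

definition smooth :: "('a::real_normed_vector \<Rightarrow> 'b::real_normed_vector) \<Rightarrow> bool" where
  "smooth f \<longleftrightarrow> (\<forall>k. C_k k f)"

definition supp :: "('a::topological_space \<Rightarrow> 'b::zero) \<Rightarrow> 'a set" where
  "supp f = closure {x. f x \<noteq> 0}"

definition test_function :: "('a::real_normed_vector \<Rightarrow> real) \<Rightarrow> bool" where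
  "test_function f \<longleftrightarrow> smooth f \<and> compact (supp f)"

definition grad :: "(real^'n \<Rightarrow> real) \<Rightarrow> real^'n \<Rightarrow> real^'n" where
  "grad f x = (\<chi> i. frechet_derivative f (at x) (axis i 1))"

section \<open>Function spaces\<close>

text \<open>Elements of Lebesgue and Sobolev spaces are given by Borel measurable representatives.\<close>

definition L2 :: "('a::euclidean_space \<Rightarrow> 'b::euclidean_space) \<Rightarrow> bool" where
  "L2 f \<longleftrightarrow> f \<in> borel_measurable lborel \<and> integrable lborel (\<lambda>x. (norm (f x))\<^sup>2)"

definition L2_norm :: "('a::euclidean_space \<Rightarrow> 'b::euclidean_space) \<Rightarrow> real" where
  "L2_norm f = sqrt (LINT x|lborel. (norm (f x))\<^sup>2)"

definition Lp_loc :: "real \<Rightarrow> 'a::euclidean_space set \<Rightarrow> ('a \<Rightarrow> real) \<Rightarrow> bool" where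
  "Lp_loc p U f \<longleftrightarrow> set_borel_measurable lborel U f \<and>
     (\<forall>K. compact K \<and> K \<subseteq> U \<longrightarrow> set_integrable lborel K (\<lambda>z. \<bar>f z\<bar> powr p))"

definition weak_gradient :: "(real^'n \<Rightarrow> real) \<Rightarrow> (real^'n \<Rightarrow> real^'n) \<Rightarrow> bool" where
  "weak_gradient f w \<longleftrightarrow> (\<forall>\<phi>. test_function \<phi> \<longrightarrow>
     (LINT x|lborel. f x *\<^sub>R grad \<phi> x) = - (LINT x|lborel. \<phi> x *\<^sub>R w x))"

text \<open>A function of \<open>(x, t)\<close> is read as the curve \<open>t \<mapsto> U(\<cdot>, t)\<close>. Derivatives and limits in
  \<open>t\<close> are taken within \<open>I\<close>, hence one-sided at an end point belonging to \<open>I\<close>.\<close>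

definition continuous_L2 ::
  "real set \<Rightarrow> ('a::euclidean_space \<times> real \<Rightarrow> 'b::euclidean_space) \<Rightarrow> bool" where
  "continuous_L2 I U \<longleftrightarrow> (\<forall>t\<in>I. L2 (\<lambda>x. U (x, t)) \<and>
     ((\<lambda>s. L2_norm (\<lambda>x. U (x, s) - U (x, t))) \<longlongrightarrow> 0) (at t within I))"

definition has_derivative_L2 ::
  "real set \<Rightarrow> ('a::euclidean_space \<times> real \<Rightarrow> real) \<Rightarrow> ('a \<times> real \<Rightarrow> real) \<Rightarrow> bool" where
  "has_derivative_L2 I U V \<longleftrightarrow> (\<forall>t\<in>I.
     ((\<lambda>s. L2_norm (\<lambda>x. (U (x, s) - U (x, t)) / (s - t) - V (x, t))) \<longlongrightarrow> 0) (at t within I))"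

text \<open>The support of an almost everywhere defined function on \<open>S\<close>, relative to \<open>S\<close>.\<close>

definition ess_supp :: "'a::euclidean_space set \<Rightarrow> ('a \<Rightarrow> real) \<Rightarrow> 'a set" where
  "ess_supp S f = {z \<in> S. \<forall>W. open W \<and> z \<in> W \<longrightarrow>
     \<not> (AE y in lborel. y \<in> W \<inter> S \<longrightarrow> f y = 0)}"

section \<open>The Cauchy problem\<close>

text \<open>Final times \<open>T\<close> are extended reals, so that global solutions (\<open>T = \<infinity>\<close>) are included.\<close>

definition time_interval :: "ereal \<Rightarrow> real set" where
  "time_interval T = {t. 0 \<le> t \<and> ereal t < T}"

text \<open>Smooth functions up to \<open>t = 0\<close> are restrictions of smooth functions on the whole
  space-time, so \<open>\<C>\<^sub>0\<^sup>\<infinity>(\<real>\<^sup>N \<times> [0, T))\<close> is represented by smooth \<open>\<Phi>\<close> on \<open>\<real>\<^sup>N \<times> \<real>\<close> with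
  compact support in \<open>\<real>\<^sup>N \<times> (-\<infinity>, T)\<close>; \<open>\<Phi>\<close> need not vanish at \<open>t = 0\<close>.\<close>

definition spacetime_test_function :: "ereal \<Rightarrow> ((real^'n) \<times> real \<Rightarrow> real) \<Rightarrow> bool" where
  "spacetime_test_function T \<Phi> \<longleftrightarrow> test_function \<Phi> \<and> supp \<Phi> \<subseteq> {(x, t). ereal t < T}"

text \<open>\<open>v\<close> and \<open>w\<close> are \<open>u\<^sub>t\<close> and \<open>\<nabla>u\<close>; they are determined by \<open>u\<close> up to null sets for every \<open>t\<close>.
  The local \<open>L\<^sup>p\<close> condition says nothing near \<open>t = 0\<close>; finiteness of the integral of
  \<open>|u\<^sub>t|\<^sup>p \<Phi>\<close>, implicit in the integral identity, is therefore stated explicitly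
  (the Bochner integral of a non-integrable function would be 0).\<close>

definition energy_solution ::
  "real \<Rightarrow> real \<Rightarrow> real \<Rightarrow> (real^'n \<Rightarrow> real) \<Rightarrow> (real^'n \<Rightarrow> real) \<Rightarrow> ereal
     \<Rightarrow> ((real^'n) \<times> real \<Rightarrow> real) \<Rightarrow> bool" where
  "energy_solution m p \<epsilon> f g T u \<longleftrightarrow> 0 < T \<and>
    (\<exists>(v :: (real^'n) \<times> real \<Rightarrow> real) (w :: (real^'n) \<times> real \<Rightarrow> real^'n).
      continuous_L2 (time_interval T) u \<and>
      continuous_L2 (time_interval T) w \<and>
      (\<forall>t\<in>time_interval T. weak_gradient (\<lambda>x. u (x, t)) (\<lambda>x. w (x, t))) \<and>
      has_derivative_L2 (time_interval T) u v \<and>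
      continuous_L2 (time_interval T) v \<and>
      Lp_loc p (UNIV \<times> {t. 0 < t \<and> ereal t < T}) v \<and>
      (AE x in lborel. u (x, 0) = \<epsilon> * f x) \<and>
      (AE x in lborel. v (x, 0) = \<epsilon> * g x) \<and>
      (\<forall>\<Phi>. spacetime_test_function T \<Phi> \<longrightarrow> (\<forall>t\<in>time_interval T.
        set_integrable lborel (UNIV \<times> {0..t}) (\<lambda>z. \<bar>v z\<bar> powr p * \<Phi> z) \<and>
        (LINT x|lborel. v (x, t) * \<Phi> (x, t))
          - (LINT x|lborel. v (x, 0) * \<Phi> (x, 0))
          - (LINT s:{0..t}|lborel. (LINT x|lborel. v (x, s) * deriv (\<lambda>r. \<Phi> (x, r)) s))
          + (LINT s:{0..t}|lborel.
               s powr (2 * m) * (LINT x|lborel. w (x, s) \<bullet> grad (\<lambda>y. \<Phi> (y, s)) x))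
        = (LINT s:{0..t}|lborel. (LINT x|lborel. \<bar>v (x, s)\<bar> powr p * \<Phi> (x, s))))))"

definition \<xi> :: "real \<Rightarrow> real \<Rightarrow> real" where
  "\<xi> m t = t powr (m + 1) / (m + 1)"

text \<open>For \<open>m \<ge> 0\<close> the denominator is positive unless \<open>N = 1\<close>; in that case there is
  no upper bound on \<open>p\<close>, as for the Glassey exponent \<open>1 + 2/(N - 1)\<close> (\<open>m = 0\<close>).\<close>

definition p_tr :: "nat \<Rightarrow> real \<Rightarrow> ereal" where
  "p_tr N m = (let d = (m + 1) * (real N - 1) - m in if d > 0 then ereal (1 + 2 / d) else \<infinity>)"

end

theory Submission
  imports Defs "HOL-Probability.Distributions"
begin

text \<open>The solution is tested against the single exponential \<open>e\<^bsup>x\<^sub>k\<^esup>\<close>, which satisfies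
  \<open>\<Delta> \<phi> = \<phi>\<close> and, like its spherical average, has mass of order \<open>r\<^bsup>(N - 1)/2\<^esup> e\<^bsup>r\<^esup>\<close> on the
  ball of radius \<open>r\<close>. For \<open>U = \<integral> u e\<^bsup>x\<^sub>k\<^esup>\<close> and \<open>V = U' = \<integral> u\<^sub>t e\<^bsup>x\<^sub>k\<^esup>\<close> the weak formulation and
  Hoelder's inequality on the support give \<open>V' \<ge> t\<^bsup>2m\<^esup> U + c V\<^bsup>p\<^esup> (t\<^bsup>(m+1)(N-1)/2\<^esup> e\<^bsup>\<xi>\<^esup>)\<^bsup>-(p-1)\<^esup>\<close>. Let
  \<open>\<rho> \<approx> t\<^bsup>-m/2\<^esup> e\<^bsup>-\<xi>\<^esup>\<close> satisfy \<open>\<rho>'' \<le> t\<^bsup>2m\<^esup> \<rho>\<close>. Then \<open>\<rho> V - \<rho>' U\<close> is at least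
  \<open>L = c \<epsilon> + \<integral> \<rho> (V' - t\<^bsup>2m\<^esup> U)\<close>, and a comparison argument improves this to \<open>\<rho> V \<ge> \<delta> L\<close>.
  Hence \<open>L' \<ge> c t\<^bsup>-b\<^esup> L\<^bsup>p\<^esup>\<close> with \<open>b = ((m+1)(N-1) - m)(p-1)/2\<close>, and integrating this
  gives the lifespan bound: \<open>b < 1\<close> below the critical exponent and \<open>b = 1\<close> at it.\<close>

section \<open>Smooth cutoff functions\<close>

text \<open>In \<open>\<rho> V - \<rho>' U\<close> the linear part of the moment inequality is
  absorbed, but the quantity still mixes U and V, whereas the nonlinearity sees V alone. The
  comparison excludes that U carries everything: while V is below a small multiple of L/\<rho>, U
  must be of order t^(-m) L/\<rho>, and then t^(2m) U drives V up fast enough. In the inequality for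
  L the exponentials cancel, since \<rho>^(1-p) grows like the factor e^((p-1)\<xi>) lost in
  Hoelder's inequality. The remaining powers of t are (m+1)(N-1)/2 from the mass on the ball and
  -m/2 from the amplitude of \<rho>, both times p-1; their difference is what fixes the critical
  exponent. Two obstacles shape the rest. The support condition is an almost everywhere statement in
  space-time, but it is needed for u and its time derivative on single time slices. And \<rho> is a
  supersolution only from a fixed time a on, so the comparison starts there; positivity of the
  moments ensures that V is still at least its initial value, which is of order \<epsilon>.\<close>

lemma C_k_const: "C_k k (\<lambda>x. c)"
  by (induction k arbitrary: c) auto

lemma C_k_Suc_D: "C_k (Suc k) f \<Longrightarrow> C_k k f"
proof (induction k arbitrary: f)
  case 0
  then show ?case
    by (auto intro!: continuous_at_imp_continuous_on differentiable_imp_continuous_within)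
next
  case (Suc k)
  from Suc.prems have "\<forall>x. f differentiable (at x)"
    and "\<And>h. C_k (Suc k) (\<lambda>x. frechet_derivative f (at x) h)" by auto
  with Suc.IH show ?case by auto
qed

lemma C_k_SucI:
  assumes "\<And>x. (f has_derivative f' x) (at x)" "\<And>h. C_k k (\<lambda>x. f' x h)"
  shows "C_k (Suc k) f"
proof -
  have "frechet_derivative f (at x) = f' x" for x
    using assms(1) by (metis frechet_derivative_at)
  then show ?thesis using assms by (auto simp: differentiable_def)
qed

lemma C_k_has_derivative:
  "C_k (Suc k) f \<Longrightarrow> (f has_derivative frechet_derivative f (at x)) (at x)"
  by (simp add: frechet_derivative_works)

lemma C_k_add: "C_k k f \<Longrightarrow> C_k k g \<Longrightarrow> C_k k (\<lambda>x. f x + g x)"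
proof (induction k arbitrary: f g)
  case 0 then show ?case by (auto intro: continuous_intros)
next
  case (Suc k)
  show ?case
    by (rule C_k_SucI[OF has_derivative_add[OF C_k_has_derivative[OF Suc.prems(1)]
          C_k_has_derivative[OF Suc.prems(2)]]])
       (use Suc in auto)
qed

lemma C_k_sum: "(\<And>i. i \<in> A \<Longrightarrow> C_k k (f i)) \<Longrightarrow> C_k k (\<lambda>x. \<Sum>i\<in>A. f i x)"
  by (induction A rule: infinite_finite_induct) (auto simp: C_k_const intro: C_k_add)

lemma C_k_mult:
  fixes f g :: "'a::real_normed_vector \<Rightarrow> 'b::real_normed_algebra"
  shows "C_k k f \<Longrightarrow> C_k k g \<Longrightarrow> C_k k (\<lambda>x. f x * g x)"
proof (induction k arbitrary: f g)
  case 0 then show ?case by (auto intro: continuous_intros)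
next
  case (Suc k)
  show ?case
    by (rule C_k_SucI[OF has_derivative_mult[OF C_k_has_derivative[OF Suc.prems(1)]
          C_k_has_derivative[OF Suc.prems(2)]]])
       (use Suc C_k_Suc_D[OF Suc.prems(1)] C_k_Suc_D[OF Suc.prems(2)] in \<open>auto intro!: C_k_add\<close>)
qed

lemma C_k_bounded_linear: "bounded_linear l \<Longrightarrow> C_k k l"
proof (cases k)
  case 0 
  assume "bounded_linear l" then show ?thesis using 0 by (auto intro: linear_continuous_on)
next
  case (Suc j)
  assume "bounded_linear l"
  then have "(l has_derivative l) (at x)" for x by (rule bounded_linear_imp_has_derivative)
  then show ?thesis unfolding Suc by (rule C_k_SucI) (rule C_k_const)
qed

lemma C_k_compose_linear: "bounded_linear l \<Longrightarrow> C_k k f \<Longrightarrow> C_k k (\<lambda>x. f (l x))"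
proof (induction k arbitrary: f)
  case 0 then show ?case
    by (auto intro: continuous_on_compose2 linear_continuous_on)
next
  case (Suc k)
  show ?case
  proof (rule C_k_SucI)
    show "((\<lambda>x. f (l x)) has_derivative (\<lambda>h. frechet_derivative f (at (l x)) (l h))) (at x)" for x
      using has_derivative_compose[OF bounded_linear_imp_has_derivative[OF Suc.prems(1)]
          C_k_has_derivative[OF Suc.prems(2)]] .
    show "C_k k (\<lambda>x. frechet_derivative f (at (l x)) (l h))" for h
      using Suc by auto
  qed
qed

text \<open>On the real line the derivative of \<open>g\<close> is multiplication by its value in
  direction 1. The chain rule therefore produces a product, and the induction closes with
  \<open>C_k_mult\<close>.\<close>

lemma C_k_compose_real:
  fixes g :: "real \<Rightarrow> real"
  shows "C_k k g \<Longrightarrow> C_k k f \<Longrightarrow> C_k k (\<lambda>x. g (f x))"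
proof (induction k arbitrary: g f)
  case 0 then show ?case
    by (auto intro: continuous_on_compose2)
next
  case (Suc k)
  show ?case
  proof (rule C_k_SucI)
    fix x
    have lin: "linear (frechet_derivative g (at (f x)))"
      using C_k_has_derivative[OF Suc.prems(1)] has_derivative_linear by blast
    have "(\<lambda>h. frechet_derivative g (at (f x)) (frechet_derivative f (at x) h)) =
      (\<lambda>h. frechet_derivative f (at x) h * frechet_derivative g (at (f x)) 1)"
    proof
      show "frechet_derivative g (at (f x)) (frechet_derivative f (at x) h) =
        frechet_derivative f (at x) h * frechet_derivative g (at (f x)) 1" for h
        using linear_scale[OF lin, of "frechet_derivative f (at x) h" 1] by simp
    qed
    then show "((\<lambda>x. g (f x)) has_derivative
       (\<lambda>h. frechet_derivative f (at x) h * frechet_derivative g (at (f x)) 1)) (at x)"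
      using has_derivative_compose[OF C_k_has_derivative[OF Suc.prems(2)]
          C_k_has_derivative[OF Suc.prems(1)], of x] by simp
  next
    show "C_k k (\<lambda>x. frechet_derivative f (at x) h * frechet_derivative g (at (f x)) 1)" for h
    proof (rule C_k_mult)
      show "C_k k (\<lambda>x. frechet_derivative g (at (f x)) 1)"
        by (rule Suc.IH) (use Suc.prems C_k_Suc_D in auto)
    qed (use Suc.prems in auto)
  qed
qed

lemma C_k_SucI_real:
  fixes f :: "real \<Rightarrow> real"
  assumes "\<And>x. (f has_real_derivative f' x) (at x)" "C_k k f'"
  shows "C_k (Suc k) f"
  by (rule C_k_SucI[OF assms(1)[unfolded has_field_derivative_def]])
     (use assms(2) in \<open>auto intro: C_k_mult C_k_const\<close>)

lemma smooth_const: "smooth (\<lambda>x. c)"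
  and smooth_add: "smooth f \<Longrightarrow> smooth g \<Longrightarrow> smooth (\<lambda>x. f x + g x)"
  and smooth_sum: "(\<And>i. i \<in> A \<Longrightarrow> smooth (F i)) \<Longrightarrow> smooth (\<lambda>x. \<Sum>i\<in>A. F i x)"
  and smooth_bounded_linear: "bounded_linear l \<Longrightarrow> smooth l"
  and smooth_compose_linear: "bounded_linear l \<Longrightarrow> smooth f \<Longrightarrow> smooth (\<lambda>x. f (l x))"
  by (auto simp: smooth_def C_k_const C_k_add C_k_sum C_k_bounded_linear C_k_compose_linear)

lemma smooth_mult:
  fixes f g :: "'a::real_normed_vector \<Rightarrow> 'b::real_normed_algebra"
  shows "smooth f \<Longrightarrow> smooth g \<Longrightarrow> smooth (\<lambda>x. f x * g x)"
  by (auto simp: smooth_def C_k_mult)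

lemma smooth_compose_real:
  fixes g :: "real \<Rightarrow> real"
  shows "smooth g \<Longrightarrow> smooth f \<Longrightarrow> smooth (\<lambda>x. g (f x))"
  by (auto simp: smooth_def C_k_compose_real)

lemma smooth_frechet_derivative: "smooth f \<Longrightarrow> smooth (\<lambda>x. frechet_derivative f (at x) h)"
  by (metis C_k.simps(2) smooth_def)

lemma smooth_continuous: "smooth f \<Longrightarrow> continuous_on UNIV f"
  unfolding smooth_def by (metis C_k.simps(1))

lemma smooth_exp: "smooth (exp :: real \<Rightarrow> real)"
  unfolding smooth_def
proof
  show "C_k k (exp :: real \<Rightarrow> real)" for k
    by (induction k) (auto intro: continuous_intros C_k_SucI_real DERIV_exp simp del: C_k.simps(2))
qed

text \<open>The functions \<open>t\<^sup>-\<^sup>j exp (- 1 / t)\<close>, extended by \<open>0\<close> to \<open>t \<le> 0\<close>, are considered for all \<open>j\<close>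
  because this family is closed, up to linear combinations, under differentiation.\<close>

definition flat :: "nat \<Rightarrow> real \<Rightarrow> real" where
  "flat j t = (if t \<le> 0 then 0 else exp (- 1 / t) / t ^ j)"

lemma flat_nonneg: "0 \<le> flat j t"
  by (auto simp: flat_def)

text \<open>On the right the substitution \<open>x = 1 / t\<close> leads to
  \<open>x ^ j / exp x\<close> at infinity; on the left there is nothing to show.\<close>

lemma flat_tendsto_0: "(flat j \<longlongrightarrow> 0) (at 0)"
proof -
  have "filterlim (\<lambda>t::real. 1 / t) at_top (at_right 0)"
    using filterlim_inverse_at_top_right by (simp add: inverse_eq_divide)
  from filterlim_compose[OF tendsto_power_div_exp_0[of j] this]
  have "((\<lambda>t::real. (1 / t) ^ j / exp (1 / t)) \<longlongrightarrow> 0) (at_right 0)" .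
  moreover have "\<forall>\<^sub>F t in at_right 0. (1 / t) ^ j / exp (1 / t) = flat j t"
    by (auto simp: flat_def eventually_at_filter exp_minus field_simps)
  ultimately have "(flat j \<longlongrightarrow> 0) (at_right 0)"
    using tendsto_cong by fast
  moreover have "\<forall>\<^sub>F t in at_left 0. flat j t = 0"
    by (auto simp: flat_def eventually_at_filter)
  then have "(flat j \<longlongrightarrow> 0) (at_left 0)"
    by (rule tendsto_eventually)
  ultimately show ?thesis by (simp add: filterlim_split_at)
qed

lemma flat_has_derivative:
  "(flat j has_real_derivative flat (j + 2) t - j * flat (j + 1) t) (at t)"
proof (cases t "0::real" rule: linorder_cases)
  case less
  have "\<forall>\<^sub>F s in nhds t. flat j s = 0"
    using eventually_nhds_in_open[of "{..<0}" t] less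
    by (auto simp: flat_def elim: eventually_mono)
  then have "(flat j has_real_derivative 0) (at t)"
    by (subst DERIV_cong_ev[OF refl _ refl, where g="\<lambda>_. 0"]) auto
  then show ?thesis using less by (simp add: flat_def)
next
  \<comment> \<open>At 0 the difference quotient of \<open>flat j\<close> is again a member of the
    family, with index \<open>Suc j\<close>, so \<open>flat_tendsto_0\<close> gives the derivative
    0.\<close>
  case equal
  have "\<forall>\<^sub>F s in at 0. flat (Suc j) s = (flat j s - flat j 0) / (s - 0)"
    by (auto simp: flat_def eventually_at_filter)
  then have "((\<lambda>s. (flat j s - flat j 0) / (s - 0)) \<longlongrightarrow> 0) (at 0)"
    using flat_tendsto_0 tendsto_cong by fast
  then have "(flat j has_real_derivative 0) (at 0)"
    by (simp add: has_field_derivative_iff)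
  then show ?thesis using equal by (simp add: flat_def)
next
  case greater
  have "\<forall>\<^sub>F s in nhds t. flat j s = exp (- 1 / s) * (1 / s) ^ j"
    using eventually_nhds_in_open[of "{0<..}" t] greater
    by (auto simp: flat_def field_simps elim: eventually_mono)
  moreover have "((\<lambda>s. exp (- 1 / s) * (1 / s) ^ j) has_real_derivative
      flat (j + 2) t - j * flat (j + 1) t) (at t)"
  proof -
    have 1: "((\<lambda>s. 1 / s) has_real_derivative - (1 / t\<^sup>2)) (at t)"
      using greater by (auto intro!: derivative_eq_intros simp: power2_eq_square)
    have 2: "((\<lambda>x. exp (- x) * x ^ j) has_real_derivative
        (exp (- x) * (j * x ^ (j - 1)) - exp (- x) * x ^ j)) (at x)" for x :: real
      by (auto intro!: derivative_eq_intros)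
    have "(exp (- (1 / t)) * (j * (1 / t) ^ (j - 1)) - exp (- (1 / t)) * (1 / t) ^ j) * - (1 / t\<^sup>2)
        = flat (j + 2) t - j * flat (j + 1) t"
      using greater by (cases j) (simp_all add: flat_def field_simps power2_eq_square)
    then show ?thesis using DERIV_chain2[OF 2 1] by simp
  qed
  ultimately show ?thesis
    by (subst DERIV_cong_ev[OF refl _ refl]) auto
qed

lemma smooth_flat: "smooth (flat j)"
  unfolding smooth_def
proof
  show "C_k k (flat j)" for k
  proof (induction k arbitrary: j)
    case 0
    then show ?case
      by (auto intro!: continuous_at_imp_continuous_on DERIV_isCont flat_has_derivative)
  next
    case (Suc k)
    have "C_k k (\<lambda>t. flat (j + 2) t + (- real j) * flat (j + 1) t)"
      by (intro C_k_add C_k_mult C_k_const Suc)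
    then show ?case
      by (intro C_k_SucI_real[OF flat_has_derivative]) simp
  qed
qed

text \<open>For negative \<open>y\<close> the interval \<open>{0..y}\<close> is empty and the
  integral is 0 by convention, so no case distinction is needed. The integrand vanishes outside the
  unit interval, hence the quotient stays 1 beyond 1.\<close>

definition smooth_step :: "real \<Rightarrow> real" where
  "smooth_step y = integral {0..y} (\<lambda>t. flat 0 t * flat 0 (1 - t))
     / integral {0..1} (\<lambda>t. flat 0 t * flat 0 (1 - t))"

lemma smooth_bump: "smooth (\<lambda>t. flat 0 t * flat 0 (1 - t))"
proof -
  have "smooth (\<lambda>t::real. 1 + (- t))"
    by (intro smooth_add smooth_const smooth_bounded_linear bounded_linear_minus bounded_linear_ident)
  then have "smooth (\<lambda>t. flat 0 (1 + (- t)))"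
    by (rule smooth_compose_real[OF smooth_flat])
  from smooth_mult[OF smooth_flat this] show ?thesis by simp
qed

lemma smooth_step_0: "y \<le> 0 \<Longrightarrow> smooth_step y = 0"
  by (cases "y = 0") (auto simp: smooth_step_def)

lemma bump_integrable: "(\<lambda>t. flat 0 t * flat 0 (1 - t)) integrable_on {a..b}"
  by (rule integrable_continuous_interval)
     (use smooth_continuous[OF smooth_bump] continuous_on_subset in blast)

lemma bump_integral_pos: "integral {0..1} (\<lambda>t. flat 0 t * flat 0 (1 - t)) > 0"
proof -
  let ?b = "\<lambda>t. flat 0 t * flat 0 (1 - t)"
  have cont: "continuous_on {0..1} ?b"
    using smooth_continuous[OF smooth_bump] continuous_on_subset by blast
  have "integral {0..1} ?b \<ge> 0"
    by (rule integral_nonneg[OF bump_integrable]) (auto simp: flat_nonneg)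
  moreover have "integral {0..1} ?b \<noteq> 0"
  proof
    assume "integral {0..1} ?b = 0"
    then have "(?b has_integral 0) (cbox 0 1)"
      using bump_integrable[of 0 1] integrable_integral by fastforce
    from has_integral_0_cbox_imp_0[OF _ _ this, of "1 / 2"] cont show False
      by (auto simp: flat_def)
  qed
  ultimately show ?thesis by simp
qed

lemma smooth_step_1: "y \<ge> 1 \<Longrightarrow> smooth_step y = 1"
proof -
  assume "y \<ge> 1"
  have "integral {1..y} (\<lambda>t. flat 0 t * flat 0 (1 - t)) = integral {1..y} (\<lambda>_. 0)"
    by (rule integral_cong) (auto simp: flat_def)
  then show ?thesis
    using Henstock_Kurzweil_Integration.integral_combine[OF _ \<open>y \<ge> 1\<close> bump_integrable[of 0 y]] bump_integral_pos
    by (simp add: smooth_step_def)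
qed

lemma smooth_step_has_derivative:
  "(smooth_step has_real_derivative flat 0 y * flat 0 (1 - y)
     / integral {0..1} (\<lambda>t. flat 0 t * flat 0 (1 - t))) (at y)"
proof -
  let ?b = "\<lambda>t. flat 0 t * flat 0 (1 - t)"
  \<comment> \<open>The lower end 0 would spoil the fundamental theorem of calculus for
    \<open>y \<le> 0\<close>. Moving it to \<open>a\<close>, left of both 0 and \<open>y\<close>,
    changes nothing near \<open>y\<close> because the integrand vanishes on the negative
    axis.\<close>
  define a where "a = - \<bar>y\<bar> - 1"
  define c where "c = \<bar>y\<bar> + 1"
  have eq: "integral {0..z} ?b = integral {a..z} ?b" if "z \<ge> a" for z
  proof (cases "z \<ge> 0")
    case True
    have "integral {a..0} ?b = integral {a..0} (\<lambda>_. 0)"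
      by (rule integral_cong) (auto simp: flat_def)
    then show ?thesis
      using Henstock_Kurzweil_Integration.integral_combine[OF _ True bump_integrable[of a z]]
      by (simp add: a_def)
  next
    case False
    have "integral {a..z} ?b = integral {a..z} (\<lambda>_. 0)"
      by (rule integral_cong) (use False in \<open>auto simp: flat_def\<close>)
    then show ?thesis using False by simp
  qed
  have "((\<lambda>z. integral {a..z} ?b) has_real_derivative ?b y) (at y within {a..c})"
    by (rule integral_has_real_derivative)
       (use smooth_continuous[OF smooth_bump] continuous_on_subset in \<open>auto simp: a_def c_def\<close>)
  then have "((\<lambda>z. integral {a..z} ?b) has_real_derivative ?b y) (at y)"
    by (subst (asm) at_within_interior) (auto simp: a_def c_def)
  moreover have ev: "\<forall>\<^sub>F z in nhds y. integral {0..z} ?b = integral {a..z} ?b"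
  proof (rule eventually_mono)
    show "\<forall>\<^sub>F z in nhds y. z \<in> {a<..}"
      by (rule eventually_nhds_in_open) (auto simp: a_def)
  qed (use eq in auto)
  ultimately have "((\<lambda>z. integral {0..z} ?b) has_real_derivative ?b y) (at y)"
    by (subst DERIV_cong_ev[OF refl ev refl])
  from DERIV_cdivide[OF this] show ?thesis by (simp add: smooth_step_def[abs_def])
qed

lemma smooth_smooth_step: "smooth smooth_step"
  unfolding smooth_def
proof
  fix k
  let ?c = "inverse (integral {0..1} (\<lambda>t. flat 0 t * flat 0 (1 - t)))"
  have "C_k k (\<lambda>y. flat 0 y * flat 0 (1 - y) * ?c)" for k
    using smooth_mult[OF smooth_bump smooth_const[of ?c]] by (simp add: smooth_def)
  then have "C_k (Suc k) smooth_step"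
    by (intro C_k_SucI_real[OF smooth_step_has_derivative]) (simp add: divide_inverse)
  then show "C_k k smooth_step" by (rule C_k_Suc_D)
qed

section \<open>Test functions and square integrable functions\<close>

lemma L2_diff: 
  assumes "L2 f" "L2 g" shows "L2 (\<lambda>x. f x - g x)"
  unfolding L2_def
proof
  show meas: "(\<lambda>x. f x - g x) \<in> borel_measurable lborel"
    using assms by (auto simp: L2_def)
  show "integrable lborel (\<lambda>x. (norm (f x - g x))\<^sup>2)"
  proof (rule Bochner_Integration.integrable_bound)
    show "integrable lborel (\<lambda>x. 2 * (norm (f x))\<^sup>2 + 2 * (norm (g x))\<^sup>2)"
      using assms by (auto simp: L2_def)
    have "(norm (f x - g x))\<^sup>2 \<le> 2 * (norm (f x))\<^sup>2 + 2 * (norm (g x))\<^sup>2" for x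
    proof -
      have "(norm (f x - g x))\<^sup>2 \<le> (norm (f x) + norm (g x))\<^sup>2"
        by (intro power_mono norm_triangle_ineq4) auto
      also have "\<dots> \<le> 2 * (norm (f x))\<^sup>2 + 2 * (norm (g x))\<^sup>2"
        using sum_squares_bound[of "norm (f x)" "norm (g x)"] by (simp add: power2_sum)
      finally show ?thesis .
    qed
    then show "AE x in lborel. norm ((norm (f x - g x))\<^sup>2) \<le> norm (2 * (norm (f x))\<^sup>2 + 2 * (norm (g x))\<^sup>2)"
      by auto
  qed (use meas in measurable)
qed

lemma L2_cmult: "L2 f \<Longrightarrow> L2 (\<lambda>x. c * f x :: real)"
  by (auto simp: L2_def abs_mult power_mult_distrib)

lemma L2_mult_integrable:
  fixes f g :: "'a::euclidean_space \<Rightarrow> real"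
  assumes "L2 f" "L2 g"
  shows "integrable lborel (\<lambda>x. f x * g x)"
proof (rule Bochner_Integration.integrable_bound)
  show "integrable lborel (\<lambda>x. (f x)\<^sup>2 + (g x)\<^sup>2)"
    using assms by (auto simp: L2_def)
  have "\<bar>f x * g x\<bar> \<le> (f x)\<^sup>2 + (g x)\<^sup>2" for x
    using sum_squares_bound[of "\<bar>f x\<bar>" "\<bar>g x\<bar>"] abs_ge_zero[of "f x * g x"] unfolding abs_mult power2_abs
    by linarith
  then show "AE x in lborel. norm (f x * g x) \<le> norm ((f x)\<^sup>2 + (g x)\<^sup>2)"
    by auto
qed (use assms in \<open>auto simp: L2_def\<close>)

lemma L2_Cauchy_Schwarz:
  fixes f g :: "'a::euclidean_space \<Rightarrow> real"
  assumes "L2 f" "L2 g"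
  shows "\<bar>LINT x|lborel. f x * g x\<bar> \<le> L2_norm f * L2_norm g"
proof -
  have int: "integrable lborel (\<lambda>x. f x * g x)" "integrable lborel (\<lambda>x. (f x)\<^sup>2)"
    "integrable lborel (\<lambda>x. (g x)\<^sup>2)"
    using assms L2_mult_integrable by (auto simp: L2_def)
  have [measurable]: "f \<in> borel_measurable lborel" "g \<in> borel_measurable lborel"
    using assms by (auto simp: L2_def)
  have "(\<integral>\<^sup>+x. ennreal \<bar>f x\<bar> * ennreal \<bar>g x\<bar> \<partial>lborel)\<^sup>2
      \<le> (\<integral>\<^sup>+x. (ennreal \<bar>f x\<bar>)\<^sup>2 \<partial>lborel) * (\<integral>\<^sup>+x. (ennreal \<bar>g x\<bar>)\<^sup>2 \<partial>lborel)"
    by (rule Cauchy_Schwarz_nn_integral) auto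
  also have "(\<integral>\<^sup>+x. (ennreal \<bar>f x\<bar>)\<^sup>2 \<partial>lborel) = ennreal (LINT x|lborel. (f x)\<^sup>2)"
    using int by (subst nn_integral_eq_integral[symmetric]) (auto simp: ennreal_power)
  also have "(\<integral>\<^sup>+x. (ennreal \<bar>g x\<bar>)\<^sup>2 \<partial>lborel) = ennreal (LINT x|lborel. (g x)\<^sup>2)"
    using int by (subst nn_integral_eq_integral[symmetric]) (auto simp: ennreal_power)
  also have "(\<integral>\<^sup>+x. ennreal \<bar>f x\<bar> * ennreal \<bar>g x\<bar> \<partial>lborel) = ennreal (LINT x|lborel. \<bar>f x * g x\<bar>)"
    using int by (subst nn_integral_eq_integral[symmetric]) (simp_all add: ennreal_mult[symmetric] flip: abs_mult)
  finally have "(LINT x|lborel. \<bar>f x * g x\<bar>)\<^sup>2 \<le> (LINT x|lborel. (f x)\<^sup>2) * (LINT x|lborel. (g x)\<^sup>2)"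
    by (simp add: ennreal_power ennreal_mult[symmetric])
  then have "(LINT x|lborel. \<bar>f x * g x\<bar>) \<le> L2_norm f * L2_norm g"
    unfolding L2_norm_def real_sqrt_mult[symmetric] by (intro real_le_rsqrt) simp
  moreover have "\<bar>LINT x|lborel. f x * g x\<bar> \<le> (LINT x|lborel. \<bar>f x * g x\<bar>)"
    by (rule integral_abs_bound)
  ultimately show ?thesis by linarith
qed

section \<open>Test functions and their derivatives\<close>

lemma test_function_bounded_support:
  assumes "smooth f" "\<And>x. x \<notin> K \<Longrightarrow> f x = 0" "compact K"
  shows "test_function f" "supp f \<subseteq> K"
proof -
  show "supp f \<subseteq> K" unfolding supp_def
    using assms by (intro closure_minimal compact_imp_closed) auto
  then show "test_function f" using assms
    unfolding test_function_def supp_def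
    by (metis closed_closure compact_Int_closed inf.absorb2)
qed

lemma not_in_supp: "x \<notin> supp f \<Longrightarrow> f x = 0"
  using closure_subset[of "{x. f x \<noteq> 0}"] by (auto simp: supp_def)

lemma test_function_frechet_derivative:
  assumes "test_function f"
  shows "test_function (\<lambda>x. frechet_derivative f (at x) h)"
proof (rule test_function_bounded_support)
  show "smooth (\<lambda>x. frechet_derivative f (at x) h)"
    using assms smooth_frechet_derivative by (auto simp: test_function_def)
  show "compact (supp f)" using assms by (simp add: test_function_def)
  fix x assume x: "x \<notin> supp f"
  have "((\<lambda>_. 0) has_derivative (\<lambda>_. 0)) (at x)" by simp
  moreover have "open (- supp f)" unfolding supp_def by (rule open_Compl[OF closed_closure])
  ultimately have "(f has_derivative (\<lambda>_. 0)) (at x)"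
    by (rule has_derivative_transform_within_open) (simp_all add: x not_in_supp)
  from frechet_derivative_at[OF this] show "frechet_derivative f (at x) h = 0"
    by metis
qed

lemma test_function_L2:
  fixes f :: "'a::euclidean_space \<Rightarrow> real"
  assumes "test_function f"
  shows "L2 f"
  unfolding L2_def
proof
  have cont: "continuous_on UNIV f"
    using assms smooth_continuous by (auto simp: test_function_def)
  then show "f \<in> borel_measurable lborel"
    by (simp add: borel_measurable_continuous_onI)
  have K: "compact (supp f)" using assms by (simp add: test_function_def)
  have "continuous_on (supp f) (\<lambda>x. (f x)\<^sup>2)"
    by (intro continuous_intros continuous_on_subset[OF cont]) auto
  from borel_integrable_compact[OF K this]
  have "integrable lborel (\<lambda>x. indicator (supp f) x *\<^sub>R (f x)\<^sup>2)"
    by (simp add: if_distrib indicator_def)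
  also have "(\<lambda>x. indicator (supp f) x *\<^sub>R (f x)\<^sup>2) = (\<lambda>x. (norm (f x))\<^sup>2)"
    by (auto simp: indicator_def fun_eq_iff not_in_supp)
  finally show "integrable lborel (\<lambda>x. (norm (f x))\<^sup>2)" .
qed

section \<open>The weak Laplacian and the cut-off test functions\<close>

definition laplacian :: "(real^'n \<Rightarrow> real) \<Rightarrow> real^'n \<Rightarrow> real" where
  "laplacian f x = (\<Sum>i\<in>UNIV. frechet_derivative (\<lambda>y. frechet_derivative f (at y) (axis i 1)) (at x) (axis i 1))"

text \<open>Each partial derivative of \<open>\<Psi>\<close> is again a test function, so the weak
  gradient identity applies to it; its component in the same direction is taken and the results are
  summed. Square integrability makes all components integrable, which is needed to take components
  of the vector-valued integrals.\<close>

lemma weak_gradient_laplacian: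
  fixes a :: "real^'n \<Rightarrow> real" and w :: "real^'n \<Rightarrow> real^'n"
  assumes "weak_gradient a w" "L2 a" "L2 w" "test_function \<Psi>"
  shows "(LINT x|lborel. w x \<bullet> grad \<Psi> x) = - (LINT x|lborel. a x * laplacian \<Psi> x)"
proof -
  define D where "D i = (\<lambda>x. frechet_derivative \<Psi> (at x) (axis i (1::real)))" for i :: 'n
  have D: "test_function (D i)" for i
    unfolding D_def by (rule test_function_frechet_derivative[OF assms(4)])
  have DD: "test_function (\<lambda>x. frechet_derivative (D i) (at x) h)" for i h
    by (rule test_function_frechet_derivative[OF D])
  have wL2: "L2 (\<lambda>x. w x $ i)" for i
    unfolding L2_def
  proof
    show [measurable]: "(\<lambda>x. w x $ i) \<in> borel_measurable lborel"
    proof (rule measurable_compose[of w lborel borel])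
      show "(\<lambda>y::real^'n. y $ i) \<in> borel_measurable borel"
        by (intro borel_measurable_continuous_onI continuous_intros)
    qed (use assms(3) in \<open>simp add: L2_def\<close>)
    show "integrable lborel (\<lambda>x. (norm (w x $ i))\<^sup>2)"
      by (rule Bochner_Integration.integrable_bound[where f="\<lambda>x. (norm (w x))\<^sup>2"])
         (use assms(3) component_le_norm_cart[of "w _" i] in \<open>auto simp: L2_def power2_le_iff_abs_le\<close>)
  qed
  have Dw: "integrable lborel (\<lambda>x. D i x * w x $ j)" for i j
    by (rule L2_mult_integrable[OF test_function_L2[OF D] wL2])
  have aD: "integrable lborel (\<lambda>x. a x * frechet_derivative (D i) (at x) h)" for i h
    by (rule L2_mult_integrable[OF assms(2) test_function_L2[OF DD]])
  have vec: "integrable lborel F" if "\<And>i. integrable lborel (\<lambda>x. F x $ i)" for F :: "real^'n \<Rightarrow> real^'n"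
  proof -
    have "integrable lborel (\<lambda>x. \<Sum>i\<in>UNIV. (F x $ i) *\<^sub>R (axis i 1 :: real^'n))"
      using that by (intro Bochner_Integration.integrable_sum integrable_scaleR_left) auto
    then show ?thesis using basis_expansion[of "F _"] by (simp add: scalar_mult_eq_scaleR)
  qed
  have comp: "(LINT x|lborel. F x) $ i = (LINT x|lborel. F x $ i)"
    if "\<And>i. integrable lborel (\<lambda>x. F x $ i)" for F :: "real^'n \<Rightarrow> real^'n" and i
    by (rule integral_bounded_linear[OF bounded_linear_vec_nth vec[OF that], symmetric])
  have "(LINT x|lborel. a x * frechet_derivative (D i) (at x) (axis i 1)) = - (LINT x|lborel. D i x * w x $ i)" for i
  proof -
    have "(LINT x|lborel. a x *\<^sub>R grad (D i) x) $ i = - (LINT x|lborel. D i x *\<^sub>R w x) $ i"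
      using assms(1) D by (simp add: weak_gradient_def)
    then show ?thesis using Dw aD by (simp add: comp grad_def)
  qed
  then have "(\<Sum>i\<in>UNIV. LINT x|lborel. a x * frechet_derivative (D i) (at x) (axis i 1))
     = - (\<Sum>i\<in>UNIV. LINT x|lborel. D i x * w x $ i)"
    by (simp add: sum_negf)
  moreover have "(\<Sum>i\<in>UNIV. LINT x|lborel. a x * frechet_derivative (D i) (at x) (axis i 1))
     = (LINT x|lborel. a x * laplacian \<Psi> x)"
    using aD by (simp add: laplacian_def D_def sum_distrib_left)
  moreover have "(\<Sum>i\<in>UNIV. LINT x|lborel. D i x * w x $ i) = (LINT x|lborel. w x \<bullet> grad \<Psi> x)"
    using Dw by (simp add: inner_vec_def grad_def D_def mult.commute)
  ultimately show ?thesis by simp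
qed

text \<open>The cutoff is a function of the polynomial \<open>x \<bullet> x\<close>, which is smooth
  at the origin, unlike the norm. The transition takes place for \<open>x \<bullet> x\<close>
  between \<open>r\<^sup>2\<close> and \<open>r\<^sup>2 + 1\<close>.\<close>

definition exp_cutoff :: "'n \<Rightarrow> real \<Rightarrow> real^'n \<Rightarrow> real" where
  "exp_cutoff k r x = exp (x $ k) * smooth_step (r\<^sup>2 + 1 - x \<bullet> x)"

lemma exp_cutoff_eq: "norm x \<le> r \<Longrightarrow> exp_cutoff k r x = exp (x $ k)"
  by (simp add: exp_cutoff_def smooth_step_1 dot_square_norm power_mono)

lemma exp_cutoff_outside: "0 \<le> r \<Longrightarrow> x \<notin> cball 0 (r + 1) \<Longrightarrow> exp_cutoff k r x = 0"
proof -
  assume "0 \<le> r" "x \<notin> cball 0 (r + 1)"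
  then have "(r + 1)\<^sup>2 \<le> (norm x)\<^sup>2" by (intro power_mono) auto
  moreover have "r\<^sup>2 + 1 \<le> (r + 1)\<^sup>2" using \<open>0 \<le> r\<close> by (simp add: power2_sum)
  ultimately show ?thesis
    by (simp add: exp_cutoff_def smooth_step_0 dot_square_norm)
qed

lemma smooth_exp_cutoff: "smooth (exp_cutoff k r)"
proof -
  have nth: "smooth (\<lambda>x::real^'n. x $ i)" for i
    by (rule smooth_bounded_linear[OF bounded_linear_vec_nth])
  have "smooth (\<lambda>x::real^'n. (r\<^sup>2 + 1) + (\<Sum>i\<in>UNIV. (- 1) * (x $ i * x $ i)))"
    by (intro smooth_add smooth_const smooth_sum smooth_mult nth)
  from smooth_compose_real[OF smooth_smooth_step this]
  have "smooth (\<lambda>x::real^'n. smooth_step (r\<^sup>2 + 1 - x \<bullet> x))"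
    by (simp add: inner_vec_def sum_negf)
  from smooth_mult[OF smooth_compose_real[OF smooth_exp nth] this]
  show ?thesis by (simp add: exp_cutoff_def[abs_def])
qed

lemma test_function_exp_cutoff: "0 \<le> r \<Longrightarrow> test_function (exp_cutoff k r)"
  by (rule test_function_bounded_support(1)[OF smooth_exp_cutoff exp_cutoff_outside compact_cball])

text \<open>The strict inequality puts \<open>x\<close> into an open set on which the cutoff is 1,
  so derivatives may be computed for the pure exponential. Only direction \<open>k\<close>
  contributes.\<close>

lemma laplacian_exp_cutoff:
  fixes x :: "real^'n"
  assumes "norm x < r"
  shows "laplacian (exp_cutoff k r) x = exp (x $ k)"
proof -
  have open_ball: "open {x::real^'n. norm x < r}"
    by (intro open_Collect_less continuous_intros)
  have 0: "((\<lambda>x. exp (x $ k)) has_derivative (\<lambda>h. exp (y $ k) * h $ k)) (at y)" for y :: "real^'n"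
    by (auto intro!: derivative_eq_intros bounded_linear.has_derivative[OF bounded_linear_vec_nth])
  have 1: "frechet_derivative (exp_cutoff k r) (at y) = (\<lambda>h. exp (y $ k) * h $ k)" if "norm y < r" for y :: "real^'n"
  proof -
    have "(exp_cutoff k r has_derivative (\<lambda>h. exp (y $ k) * h $ k)) (at y)"
      by (rule has_derivative_transform_within_open[OF 0 open_ball]) (use that in \<open>auto simp: exp_cutoff_eq\<close>)
    from frechet_derivative_at[OF this] show ?thesis by (rule sym)
  qed
  have 2: "frechet_derivative (\<lambda>y. frechet_derivative (exp_cutoff k r) (at y) (axis i 1)) (at x)
     = (\<lambda>h. exp (x $ k) * h $ k * axis i 1 $ k)" for i
  proof -
    have "((\<lambda>y. frechet_derivative (exp_cutoff k r) (at y) (axis i 1)) has_derivative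
        (\<lambda>h. exp (x $ k) * h $ k * axis i 1 $ k)) (at x)"
      by (rule has_derivative_transform_within_open[OF has_derivative_mult_left[OF 0] open_ball])
         (use assms 1 in auto)
    from frechet_derivative_at[OF this] show ?thesis by (rule sym)
  qed
  show ?thesis unfolding laplacian_def 2
    by (subst sum.remove[of _ k]) (auto simp: axis_def intro!: sum.neutral)
qed

text \<open>For \<open>t < b\<close> this is 1 on a neighbourhood of \<open>{0..t}\<close>, so that
  no time derivative of the test function survives there, and it is supported in
  \<open>{-2..b}\<close>. The descent on the negative axis only serves to make the support
  compact.\<close>

definition time_cutoff :: "real \<Rightarrow> real \<Rightarrow> real \<Rightarrow> real" where
  "time_cutoff t b s = smooth_step (s + 2) * smooth_step (2 * (b - s) / (b - t))"

lemma time_cutoff_eq: "t < b \<Longrightarrow> -1 \<le> s \<Longrightarrow> s \<le> (t + b) / 2 \<Longrightarrow> time_cutoff t b s = 1"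
  by (simp add: time_cutoff_def smooth_step_1 field_simps)

lemma time_cutoff_outside: "t < b \<Longrightarrow> s \<notin> {-2..b} \<Longrightarrow> time_cutoff t b s = 0"
  by (auto simp: time_cutoff_def smooth_step_0 divide_nonpos_pos)

lemma smooth_time_cutoff: "smooth (time_cutoff t b)"
proof -
  have id: "smooth (\<lambda>s::real. s)" by (rule smooth_bounded_linear[OF bounded_linear_ident])
  have "smooth (\<lambda>s::real. s + 2)" "smooth (\<lambda>s. 2 * b / (b - t) + (- 2 / (b - t)) * s)"
    by (intro smooth_add smooth_mult smooth_const id)+
  from smooth_mult[OF this[THEN smooth_compose_real[OF smooth_smooth_step]]]
  show ?thesis by (simp add: time_cutoff_def[abs_def] diff_divide_distrib right_diff_distrib)
qed

lemma spacetime_cutoff: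
  assumes "t < b" "ereal b < T" "0 \<le> r"
  shows "spacetime_test_function T (\<lambda>z. exp_cutoff k r (fst z) * time_cutoff t b (snd z))"
proof -
  let ?\<Phi> = "\<lambda>z. exp_cutoff k r (fst z) * time_cutoff t b (snd z)"
  have sm: "smooth ?\<Phi>"
    by (intro smooth_mult smooth_compose_linear[OF bounded_linear_fst smooth_exp_cutoff]
        smooth_compose_linear[OF bounded_linear_snd smooth_time_cutoff])
  have out: "?\<Phi> z = 0" if "z \<notin> cball 0 (r + 1) \<times> {-2..b}" for z
    using that exp_cutoff_outside[OF assms(3), of "fst z" k] time_cutoff_outside[OF assms(1), of "snd z"]
    by (cases z) auto
  have K: "compact (cball (0::real^'n) (r + 1) \<times> {-2..b})"
    by (intro compact_Times compact_cball compact_Icc)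
  note * = test_function_bounded_support[OF sm out K]
  have "cball (0::real^'n) (r + 1) \<times> {-2..b} \<subseteq> {(x, t). ereal t < T}"
    using assms(2) by (auto intro: le_less_trans[of "ereal _" "ereal b"])
  with * show ?thesis by (auto simp: spacetime_test_function_def)
qed

section \<open>Integral estimates\<close>

text \<open>The convex function \<open>y powr p\<close> lies above its tangent at \<open>k\<close>;
  this is Young's inequality for conjugate exponents. Integrated against a weight, with a suitable
  \<open>k\<close>, it takes the place of Hoelder's inequality.\<close>

lemma powr_above_tangent:
  assumes "1 < p" "0 \<le> y" "0 \<le> k"
  shows "p * (y * k powr (p - 1)) - (p - 1) * k powr p \<le> (y::real) powr p"
proof -
  have eq: "(k powr (p - 1)) powr (p / (p - 1)) = k powr p"
    using assms(1) by (simp add: powr_powr)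
  have "y * k powr (p - 1) \<le> y powr p / p + (k powr (p - 1)) powr (p / (p - 1)) / (p / (p - 1))"
    using assms by (intro Youngs_inequality) (auto simp: field_simps)
  also have "\<dots> = (y powr p + (p - 1) * k powr p) / p"
    unfolding eq using assms(1) by (simp add: field_simps)
  finally show ?thesis using assms(1) by (simp add: field_simps)
qed

lemma nn_integral_gaussian:
  assumes "r > 0"
  shows "(\<integral>\<^sup>+x. ennreal (exp (- x\<^sup>2 / (4 * r))) \<partial>lborel) = ennreal (sqrt (4 * pi * r))"
proof -
  have s: "0 < sqrt (2 * r)" using assms by simp
  have "(\<integral>\<^sup>+x. ennreal (exp (- x\<^sup>2 / (4 * r))) \<partial>lborel)
      = (\<integral>\<^sup>+x. ennreal (sqrt (4 * pi * r)) * ennreal (normal_density 0 (sqrt (2 * r)) x) \<partial>lborel)"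
    using assms by (intro nn_integral_cong) (simp add: normal_density_def ennreal_mult[symmetric] mult_ac)
  also have "\<dots> = ennreal (sqrt (4 * pi * r)) * (\<integral>\<^sup>+x. ennreal (normal_density 0 (sqrt (2 * r)) x) \<partial>lborel)"
    by (rule nn_integral_cmult) simp
  also have "(\<integral>\<^sup>+x. ennreal (normal_density 0 (sqrt (2 * r)) x) \<partial>lborel) = 1"
    using s by (subst nn_integral_eq_integral) auto
  finally show ?thesis by simp
qed

lemma nn_integral_exp_atMost:
  "(\<integral>\<^sup>+y. ennreal (indicator {..r} y * exp ((y - r) / 2)) \<partial>lborel) = 2" for r :: real
proof -
  have "(\<integral>\<^sup>+y. ennreal (indicator {..r} y * exp ((y - r) / 2)) \<partial>lborel)
      = (\<integral>\<^sup>+x. ennreal (indicator {..r} (r - x) * exp (((r - x) - r) / 2)) \<partial>lborel)"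
    by (subst nn_integral_real_affine[where c = "-1" and t = r]) auto
  also have "\<dots> = (\<integral>\<^sup>+x. ennreal (exp (- x / 2)) * indicator {0..} x \<partial>lborel)"
    by (intro nn_integral_cong) (auto simp: indicator_def)
  also have "\<dots> = ennreal (0 - (- 2 * exp (- 0 / 2)))"
  proof (rule nn_integral_FTC_atLeast)
    have "filterlim (\<lambda>x::real. - x / 2) at_bot at_top"
      unfolding filterlim_at_bot
    proof
      fix Z :: real
      show "\<forall>\<^sub>F x in at_top. - x / 2 \<le> Z"
        using eventually_ge_at_top[of "- 2 * Z"] by eventually_elim simp
    qed
    from tendsto_mult_right_zero[OF filterlim_compose[OF exp_at_bot this]]
    show "((\<lambda>x::real. - 2 * exp (- x / 2)) \<longlongrightarrow> 0) at_top" .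
  qed (auto intro!: derivative_eq_intros)
  finally show ?thesis by simp
qed

text \<open>On the ball \<open>x\<^sub>k\<close> is at most \<open>r\<close>, and \<open>r - x\<^sub>k\<close> controls the squares of the other
  coordinates. Half of the decay of \<open>exp (x\<^sub>k - r)\<close> is spent on a Gaussian in these, which
  produces the factor \<open>r\<^bsup>(N - 1)/2\<^esup>\<close>.\<close>

lemma exp_ball_bound:
  fixes k :: "'n::finite" and r :: real
  assumes "r > 0"
  defines "M \<equiv> 2 * exp r * sqrt (4 * pi * r) ^ (CARD('n) - 1)"
  shows "integrable lborel (\<lambda>x::real^'n. indicator (cball 0 r) x * exp (x $ k))" (is "integrable _ ?f")
    and "(LINT x|lborel. indicator (cball (0::real^'n) r) x * exp (x $ k)) \<le> M"
proof -
  define h where "h b y = (if b = axis k 1 then indicator {..r} y * exp ((y - r) / 2) else exp (- y\<^sup>2 / (4 * r)))"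
    for b :: "real^'n" and y :: real
  have k: "axis k 1 \<in> (Basis :: (real^'n) set)" by simp
  have bound: "?f x \<le> exp r * (\<Prod>b\<in>Basis. h b (x \<bullet> b))" for x
  proof (cases "x \<in> cball 0 r")
    case True
    let ?B = "Basis - {axis k 1 :: real^'n}"
    have norm: "norm x \<le> r" using True by simp
    have xk: "x \<bullet> axis k 1 = x $ k" by (simp add: inner_axis)
    have xr: "\<bar>x $ k\<bar> \<le> r" using component_le_norm_cart[of x k] norm by simp
    have "(norm x)\<^sup>2 = (\<Sum>b\<in>Basis. (x \<bullet> b)\<^sup>2)"
      unfolding power2_norm_eq_inner by (subst euclidean_inner) (simp add: power2_eq_square)
    also have "\<dots> = (x $ k)\<^sup>2 + (\<Sum>b\<in>?B. (x \<bullet> b)\<^sup>2)"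
      using k xk by (subst sum.remove[of _ "axis k 1"]) auto
    finally have "(\<Sum>b\<in>?B. (x \<bullet> b)\<^sup>2) \<le> r\<^sup>2 - (x $ k)\<^sup>2"
      using power_mono[OF norm, of 2] by simp
    also have "\<dots> = (r - x $ k) * (r + x $ k)" by (simp add: power2_eq_square algebra_simps)
    \<comment> \<open>After division by \<open>4 * r\<close> exactly half of
      \<open>r - x $ k\<close> remains, which is why the Gaussian has the exponent
      \<open>- x\<^sup>2 / (4 * r)\<close>.\<close>
    also have "\<dots> \<le> (r - x $ k) * (2 * r)" using xr by (intro mult_left_mono) auto
    finally have "(\<Sum>b\<in>?B. (x \<bullet> b)\<^sup>2) / (4 * r) \<le> (r - x $ k) / 2"
      using assms by (simp add: field_simps)
    then have le: "x $ k \<le> r + (x $ k - r) / 2 - (\<Sum>b\<in>?B. (x \<bullet> b)\<^sup>2) / (4 * r)"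
      by (simp add: field_simps)
    have "(\<Prod>b\<in>Basis. h b (x \<bullet> b)) = h (axis k 1) (x \<bullet> axis k 1) * (\<Prod>b\<in>?B. h b (x \<bullet> b))"
      using k by (subst prod.remove[of _ "axis k 1"]) auto
    also have "(\<Prod>b\<in>?B. h b (x \<bullet> b)) = (\<Prod>b\<in>?B. exp (- (x \<bullet> b)\<^sup>2 / (4 * r)))"
      by (intro prod.cong) (auto simp: h_def)
    also have "\<dots> = exp (\<Sum>b\<in>?B. - (x \<bullet> b)\<^sup>2 / (4 * r))"
      by (rule exp_sum[symmetric]) simp
    also have "(\<Sum>b\<in>?B. - (x \<bullet> b)\<^sup>2 / (4 * r)) = - (\<Sum>b\<in>?B. (x \<bullet> b)\<^sup>2) / (4 * r)"
      by (simp add: sum_negf sum_divide_distrib)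
    also have "h (axis k 1) (x \<bullet> axis k 1) = exp ((x $ k - r) / 2)"
      using xr by (simp add: h_def xk)
    finally have "exp r * (\<Prod>b\<in>Basis. h b (x \<bullet> b))
        = exp (r + ((x $ k - r) / 2 + - (\<Sum>b\<in>?B. (x \<bullet> b)\<^sup>2) / (4 * r)))"
      by (simp only: mult_exp_exp)
    then show ?thesis using le True by (simp add: add_diff_eq)
  next
    case False
    then show ?thesis by (auto simp: h_def intro!: mult_nonneg_nonneg prod_nonneg)
  qed
  have meas: "?f \<in> borel_measurable lborel"
    by (intro borel_measurable_times borel_measurable_indicator borel_measurable_exp)
       (auto intro!: borel_measurable_continuous_onI continuous_intros)
  have hmeas: "h b \<in> borel_measurable borel" for b by (cases "b = axis k 1") (auto simp: h_def[abs_def])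
  have "(\<lambda>x::real^'n. x \<bullet> b) \<in> borel_measurable lborel" for b
    by simp
  then have [measurable]: "(\<lambda>x. h b (x \<bullet> b)) \<in> borel_measurable lborel" for b
    using hmeas by (rule measurable_compose)
  have "(\<integral>\<^sup>+x. ennreal (norm (?f x)) \<partial>lborel) \<le> (\<integral>\<^sup>+x. ennreal (exp r) * (\<Prod>b\<in>Basis. ennreal (h b (x \<bullet> b))) \<partial>lborel)"
  proof (rule nn_integral_mono)
    fix x :: "real^'n"
    have "ennreal (norm (?f x)) \<le> ennreal (exp r * (\<Prod>b\<in>Basis. h b (x \<bullet> b)))"
      by (rule ennreal_leI) (use bound[of x] in simp)
    also have "\<dots> = ennreal (exp r) * (\<Prod>b\<in>Basis. ennreal (h b (x \<bullet> b)))"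
      by (subst prod_ennreal) (auto simp: h_def ennreal_mult prod_nonneg)
    finally show "ennreal (norm (?f x)) \<le> ennreal (exp r) * (\<Prod>b\<in>Basis. ennreal (h b (x \<bullet> b)))" .
  qed
  also have "\<dots> = ennreal (exp r) * (\<integral>\<^sup>+x. (\<Prod>b\<in>Basis. ennreal (h b (x \<bullet> b))) \<partial>lborel)"
    by (rule nn_integral_cmult) simp
  also have "(\<integral>\<^sup>+x. (\<Prod>b\<in>Basis. ennreal (h b (x \<bullet> b))) \<partial>(lborel :: (real^'n) measure))
     = (\<Prod>b\<in>(Basis :: (real^'n) set). \<integral>\<^sup>+y. ennreal (h b y) \<partial>lborel)"
    using hmeas by (intro nn_integral_lborel_prod) (auto simp: h_def)
  also have "\<dots> = (\<integral>\<^sup>+y. ennreal (h (axis k 1) y) \<partial>lborel) *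
      (\<Prod>b\<in>Basis - {axis k 1 :: real^'n}. \<integral>\<^sup>+y. ennreal (h b y) \<partial>lborel)"
    using k by (subst prod.remove[of _ "axis k 1"]) auto
  also have "(\<integral>\<^sup>+y. ennreal (h (axis k 1) y) \<partial>lborel) = 2"
    using nn_integral_exp_atMost by (simp add: h_def)
  also have "(\<Prod>b\<in>Basis - {axis k 1 :: real^'n}. \<integral>\<^sup>+y. ennreal (h b y) \<partial>lborel)
     = (\<Prod>b\<in>Basis - {axis k 1 :: real^'n}. ennreal (sqrt (4 * pi * r)))"
    using nn_integral_gaussian[OF assms(1)] by (intro prod.cong) (auto simp: h_def)
  also have "\<dots> = ennreal (sqrt (4 * pi * r)) ^ (CARD('n) - 1)"
    using k by (simp add: card_Diff_singleton)
  also have "ennreal (exp r) * (2 * ennreal (sqrt (4 * pi * r)) ^ (CARD('n) - 1)) = ennreal M"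
    using assms by (simp add: M_def ennreal_mult ennreal_power mult_ac)
  finally have nn: "(\<integral>\<^sup>+x. ennreal (norm (?f x)) \<partial>lborel) \<le> ennreal M" .
  show int: "integrable lborel ?f"
    using meas nn by (intro integrableI_bounded) (auto intro: le_less_trans)
  have "ennreal (LINT x|lborel. ?f x) = (\<integral>\<^sup>+x. ennreal (norm (?f x)) \<partial>lborel)"
    using int by (subst nn_integral_eq_integral[symmetric]) auto
  then show "(LINT x|lborel. ?f x) \<le> M"
    using nn assms(1) by (subst ennreal_le_iff[symmetric]) (simp_all add: M_def)
qed

section \<open>Almost everywhere statements and their time slices\<close>

lemma AE_dense:
  assumes "AE s in lborel. P s" "c < (d::real)"
  shows "\<exists>s. c < s \<and> s < d \<and> P s"
proof (rule ccontr)
  assume no: "\<not> ?thesis"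
  have "AE s in lborel. s \<notin> {c<..<d}"
    using assms(1) by eventually_elim (use no in auto)
  then have "emeasure lborel {c<..<d} = 0"
    by (subst (asm) AE_iff_measurable[where N = "{c<..<d}"]) auto
  then show False using assms(2) by simp
qed

text \<open>Every point of \<open>S\<close> outside the essential support has a neighbourhood on
  which \<open>f\<close> vanishes almost everywhere, but these are uncountably many. Lindelof's
  theorem selects countably many with the same union, so the exceptional sets add up to a null
  set.\<close>

lemma ess_supp_AE:
  "AE z in lborel. z \<in> S \<longrightarrow> z \<notin> ess_supp S f \<longrightarrow> f z = 0"
proof -
  define F where "F = {W. open W \<and> (AE y in lborel. y \<in> W \<inter> S \<longrightarrow> f y = 0)}"
  have "\<And>W. W \<in> F \<Longrightarrow> open W" by (simp add: F_def)
  from Lindelof[OF this] obtain F' where F': "F' \<subseteq> F" "countable F'" "\<Union>F' = \<Union>F" by metis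
  have "AE z in lborel. \<forall>W\<in>F'. z \<in> W \<inter> S \<longrightarrow> f z = 0"
    using F' by (intro AE_ball_countable') (auto simp: F_def)
  then show ?thesis
  proof eventually_elim
    case (elim z)
    show ?case
    proof (intro impI)
      assume z: "z \<in> S" "z \<notin> ess_supp S f"
      then obtain W where "W \<in> F" "z \<in> W" unfolding ess_supp_def F_def by blast
      then have "z \<in> \<Union>F'" unfolding F'(3) by blast
      then show "f z = 0" using elim z by blast
    qed
  qed
qed

text \<open>Fubini's theorem for null sets fixes the first coordinate. Swapping the factors gives
  slices at a fixed second coordinate, which will be the time.\<close>

lemma AE_lborel_slices:
  fixes Q :: "'a::euclidean_space \<Rightarrow> 'b::euclidean_space \<Rightarrow> bool"
  assumes "AE z in lborel. Q (fst z) (snd z)"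
  shows "AE t in lborel. AE x in lborel. Q x t"
proof -
  have "AE z in lborel \<Otimes>\<^sub>M lborel. Q (fst z) (snd z)"
    unfolding lborel_prod by (rule assms)
  then have "AE z in distr (lborel \<Otimes>\<^sub>M lborel) (lborel \<Otimes>\<^sub>M lborel) (\<lambda>(x, y). (y, x)). Q (fst z) (snd z)"
    using lborel_pair.distr_pair_swap by metis
  from AE_distrD[OF measurable_pair_swap' this]
  have "AE z in lborel \<Otimes>\<^sub>M lborel. Q (snd z) (fst z)"
    by (simp add: case_prod_beta)
  from lborel_pair.AE_pair[OF this] show ?thesis by simp
qed

section \<open>Finite speed of propagation\<close>

text \<open>If \<open>G\<close> had mass \<open>a > 0\<close> on \<open>E\<close>, then every
  \<open>F s\<close> vanishing on \<open>E\<close> would stay at distance at least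
  \<open>sqrt a\<close> from \<open>G\<close>. Frequent rather than eventual vanishing is assumed
  because slices of an almost everywhere statement are controlled at almost every time only.\<close>

lemma L2_limit_vanish:
  fixes F :: "'s \<Rightarrow> 'a::euclidean_space \<Rightarrow> real"
  assumes lim: "((\<lambda>s. L2_norm (\<lambda>x. F s x - G x)) \<longlongrightarrow> 0) A"
    and freq: "\<exists>\<^sub>F s in A. L2 (F s) \<and> (AE x in lborel. x \<in> E \<longrightarrow> F s x = 0)"
    and G: "L2 G" and [measurable]: "E \<in> sets borel"
  shows "AE x in lborel. x \<in> E \<longrightarrow> G x = 0"
proof -
  define a where "a = (LINT x|lborel. indicator E x * (G x)\<^sup>2)"
  have [measurable]: "G \<in> borel_measurable borel" using G by (simp add: L2_def)
  have Gint: "integrable lborel (\<lambda>x. (G x)\<^sup>2)" using G by (simp add: L2_def)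
  have int: "integrable lborel (\<lambda>x. indicator E x * (G x)\<^sup>2)"
    by (rule Bochner_Integration.integrable_bound[OF Gint]) (auto simp: indicator_def)
  have "a = 0"
  proof (rule ccontr)
    assume "a \<noteq> 0"
    then have "a > 0" by (simp add: a_def order_less_le)
    then have "\<forall>\<^sub>F s in A. L2_norm (\<lambda>x. F s x - G x) < sqrt a"
      by (intro order_tendstoD(2)[OF lim]) simp
    from frequently_eventually_conj[OF freq this] obtain s where
      s: "L2 (F s)" "AE x in lborel. x \<in> E \<longrightarrow> F s x = 0" "L2_norm (\<lambda>x. F s x - G x) < sqrt a"
      using frequently_ex by fast
    have [measurable]: "F s \<in> borel_measurable borel" using s by (simp add: L2_def)
    have intd: "integrable lborel (\<lambda>x. (F s x - G x)\<^sup>2)"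
      using L2_diff[OF s(1) G] by (simp add: L2_def)
    have "a \<le> (LINT x|lborel. (F s x - G x)\<^sup>2)"
      unfolding a_def using int intd
    proof (rule integral_mono_AE)
      show "AE x in lborel. indicator E x * (G x)\<^sup>2 \<le> (F s x - G x)\<^sup>2"
        using s(2) by eventually_elim (auto simp: indicator_def)
    qed
    then show False using s(3) by (simp add: L2_norm_def)
  qed
  then have "AE x in lborel. indicator E x * (G x)\<^sup>2 = 0"
    unfolding a_def using int by (subst (asm) integral_nonneg_eq_0_iff_AE) auto
  then show ?thesis by eventually_elim (auto simp: indicator_def)
qed

lemma \<xi>_mono: "0 \<le> m \<Longrightarrow> 0 \<le> s \<Longrightarrow> s \<le> t \<Longrightarrow> \<xi> m s \<le> \<xi> m t"
  unfolding \<xi>_def by (intro divide_right_mono powr_mono2) auto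

lemma \<xi>_nonneg: "0 \<le> m \<Longrightarrow> 0 \<le> \<xi> m t"
  unfolding \<xi>_def by (rule divide_nonneg_nonneg[OF powr_ge_zero]) linarith

lemma continuous_on_\<xi>: "0 \<le> m \<Longrightarrow> continuous_on {0..} (\<xi> m)"
  unfolding \<xi>_def[abs_def]
  by (intro continuous_on_divide continuous_on_powr' continuous_on_const continuous_on_id) auto

text \<open>Supplies the approximating times for \<open>L2_limit_vanish\<close>. They are taken to
  the right of \<open>t\<close>, which is possible at 0 as well and before the open end
  \<open>T\<close>; the strict gap below \<open>r\<close> absorbs the growth of the support
  radius.\<close>

lemma frequently_time:
  assumes "AE s in lborel. P s" "t \<in> time_interval T" "\<xi> m t + R < r" "0 \<le> m"
  shows "\<exists>\<^sub>F s in at t within time_interval T. s \<in> time_interval T \<and> P s \<and> \<xi> m s + R < r"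
  unfolding frequently_def
proof
  assume "\<forall>\<^sub>F s in at t within time_interval T. \<not> (s \<in> time_interval T \<and> P s \<and> \<xi> m s + R < r)"
  then obtain d where d: "d > 0" "\<And>s. s \<in> time_interval T \<Longrightarrow> s \<noteq> t \<Longrightarrow> dist s t < d \<Longrightarrow>
      \<not> (s \<in> time_interval T \<and> P s \<and> \<xi> m s + R < r)"
    unfolding eventually_at by blast
  have t: "0 \<le> t" "ereal t < T" using assms(2) by (auto simp: time_interval_def)
  have "continuous (at t within {0..}) (\<xi> m)"
    using continuous_on_\<xi>[OF assms(4)] t by (auto simp: continuous_on_eq_continuous_within)
  then have "(\<xi> m \<longlongrightarrow> \<xi> m t) (at t within {0..})"
    by (simp add: continuous_within)
  then have "\<forall>\<^sub>F s in at t within {0..}. \<xi> m s < r - R"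
    by (rule order_tendstoD) (use assms(3) in simp)
  then obtain d2 where d2: "d2 > 0" "\<And>s. s \<ge> 0 \<Longrightarrow> s \<noteq> t \<Longrightarrow> dist s t < d2 \<Longrightarrow> \<xi> m s < r - R"
    unfolding eventually_at by auto
  obtain b where b: "t < b" "ereal b < T"
    using ereal_dense2[OF t(2)] by auto
  define c where "c = min b (min (t + d) (t + d2))"
  have "t < c" using b d(1) d2(1) by (simp add: c_def)
  from AE_dense[OF assms(1) this] obtain s where s: "t < s" "s < c" "P s" by blast
  have "ereal s < T" using s b by (intro less_trans[OF _ b(2)]) (simp add: c_def)
  then have I: "s \<in> time_interval T" using s t by (simp add: time_interval_def)
  have "\<xi> m s < r - R"
    by (rule d2(2)) (use s t in \<open>auto simp: c_def dist_real_def\<close>)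
  moreover have "\<not> (s \<in> time_interval T \<and> P s \<and> \<xi> m s + R < r)"
    by (rule d(2)) (use s I in \<open>auto simp: c_def dist_real_def\<close>)
  ultimately show False using I s(3) by simp
qed

text \<open>The limit arguments require a radius strictly larger than the claimed one. The radii
  \<open>\<rho> + 1 / (n + 1)\<close> recover the sharp radius with countably many null
  sets.\<close>

lemma AE_outside_ball:
  fixes G :: "'a::real_normed_vector \<Rightarrow> real"
  assumes "\<And>r. \<rho> < r \<Longrightarrow> AE x in M. r < norm x \<longrightarrow> G x = 0"
  shows "AE x in M. \<rho> < norm x \<longrightarrow> G x = 0"
proof -
  have "AE x in M. \<forall>n::nat. \<rho> + 1 / real (Suc n) < norm x \<longrightarrow> G x = 0"
    unfolding AE_all_countable by (intro allI assms) simp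
  then show ?thesis
  proof eventually_elim
    case (elim x)
    show ?case
    proof
      assume "\<rho> < norm x"
      then obtain n where "1 / real (Suc n) < norm x - \<rho>"
        using nat_approx_posE[of "norm x - \<rho>"] by auto
      then have "\<rho> + 1 / real (Suc n) < norm x" by simp
      then show "G x = 0" using elim by blast
    qed
  qed
qed

context
  fixes u v :: "(real^'n) \<times> real \<Rightarrow> real" and T :: ereal and m R :: real
  assumes m: "0 \<le> m"
    and contu: "continuous_L2 (time_interval T) u"
    and supp: "ess_supp (UNIV \<times> time_interval T) u \<subseteq> {(x, t). 0 \<le> t \<and> norm x \<le> \<xi> m t + R}"
begin

text \<open>Slicing the space-time condition settles almost every time; continuity in
  \<open>L2\<close> carries the vanishing over to the remaining times, in particular to 0.\<close>

lemma solution_support: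
  assumes t: "t \<in> time_interval T"
  shows "AE x in lborel. \<xi> m t + R < norm x \<longrightarrow> u (x, t) = 0"
proof (rule AE_outside_ball)
  fix r assume r: "\<xi> m t + R < r"
  have [measurable]: "{x::real^'n. r < norm x} \<in> sets borel"
    by (intro borel_open open_Collect_less continuous_intros)
  have "AE z in lborel. snd z \<in> time_interval T \<longrightarrow> \<xi> m (snd z) + R < norm (fst z) \<longrightarrow> u (fst z, snd z) = 0"
    using ess_supp_AE[of "UNIV \<times> time_interval T" u]
  proof eventually_elim
    case (elim z)
    obtain x s where z: "z = (x, s)" by (cases z)
    have "z \<notin> ess_supp (UNIV \<times> time_interval T) u" if "\<xi> m s + R < norm x"
      using supp that unfolding z by fastforce
    then show ?case using elim z by auto
  qed
  from AE_lborel_slices[OF this]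
  have ae: "AE s in lborel. AE x in lborel. s \<in> time_interval T \<longrightarrow> \<xi> m s + R < norm x \<longrightarrow> u (x, s) = 0" .
  have "AE x in lborel. x \<in> {x. r < norm x} \<longrightarrow> u (x, t) = 0"
  proof (rule L2_limit_vanish)
    show "((\<lambda>s. L2_norm (\<lambda>x. u (x, s) - u (x, t))) \<longlongrightarrow> 0) (at t within time_interval T)"
      "L2 (\<lambda>x. u (x, t))"
      using contu t by (auto simp: continuous_L2_def)
    show "\<exists>\<^sub>F s in at t within time_interval T. L2 (\<lambda>x. u (x, s)) \<and>
        (AE x in lborel. x \<in> {x. r < norm x} \<longrightarrow> u (x, s) = 0)"
    proof (rule frequently_elim1[OF frequently_time[OF ae t r m]])
      fix s
      assume s: "s \<in> time_interval T \<and>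
        (AE x in lborel. s \<in> time_interval T \<longrightarrow> \<xi> m s + R < norm x \<longrightarrow> u (x, s) = 0) \<and> \<xi> m s + R < r"
      then have "AE x in lborel. s \<in> time_interval T \<longrightarrow> \<xi> m s + R < norm x \<longrightarrow> u (x, s) = 0" by blast
      then have "AE x in lborel. x \<in> {x. r < norm x} \<longrightarrow> u (x, s) = 0"
        by eventually_elim (use s in auto)
      then show "L2 (\<lambda>x. u (x, s)) \<and> (AE x in lborel. x \<in> {x. r < norm x} \<longrightarrow> u (x, s) = 0)"
        using contu s by (auto simp: continuous_L2_def)
    qed
  qed simp
  then show "AE x in lborel. r < norm x \<longrightarrow> u (x, t) = 0" by simp
qed

text \<open>Near \<open>t\<close> the difference quotients vanish outside any strictly larger ball,
  by \<open>solution_support\<close> at both times, and \<open>v\<close> is their limit in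
  \<open>L2\<close>.\<close>

lemma time_derivative_support:
  assumes t: "t \<in> time_interval T"
    and der: "has_derivative_L2 (time_interval T) u v" and contv: "continuous_L2 (time_interval T) v"
  shows "AE x in lborel. \<xi> m t + R < norm x \<longrightarrow> v (x, t) = 0"
proof (rule AE_outside_ball)
  fix r assume r: "\<xi> m t + R < r"
  have [measurable]: "{x::real^'n. r < norm x} \<in> sets borel"
    by (intro borel_open open_Collect_less continuous_intros)
  have "AE x in lborel. x \<in> {x. r < norm x} \<longrightarrow> v (x, t) = 0"
  proof (rule L2_limit_vanish)
    show "((\<lambda>s. L2_norm (\<lambda>x. (u (x, s) - u (x, t)) / (s - t) - v (x, t))) \<longlongrightarrow> 0) (at t within time_interval T)"
      "L2 (\<lambda>x. v (x, t))"
      using der contv t by (auto simp: continuous_L2_def has_derivative_L2_def)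
    \<comment> \<open>Every slice of \<open>u\<close> is under control by now, so no null set of
      times has to be avoided.\<close>
    have ae: "AE s::real in lborel. True" by simp
    show "\<exists>\<^sub>F s in at t within time_interval T. L2 (\<lambda>x. (u (x, s) - u (x, t)) / (s - t)) \<and>
        (AE x in lborel. x \<in> {x. r < norm x} \<longrightarrow> (u (x, s) - u (x, t)) / (s - t) = 0)"
    proof (rule frequently_elim1[OF frequently_time[OF ae t r m]], safe)
      fix s assume s: "s \<in> time_interval T" "\<xi> m s + R < r"
      have "L2 (\<lambda>x. inverse (s - t) * (u (x, s) - u (x, t)))"
        using contu s t by (intro L2_cmult L2_diff) (auto simp: continuous_L2_def)
      then show "L2 (\<lambda>x. (u (x, s) - u (x, t)) / (s - t))" by (simp add: divide_inverse mult.commute)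
      show "AE x in lborel. x \<in> {x. r < norm x} \<longrightarrow> (u (x, s) - u (x, t)) / (s - t) = 0"
        using solution_support[OF s(1)] solution_support[OF t]
        by eventually_elim (use s r in auto)
    qed
  qed simp
  then show "AE x in lborel. r < norm x \<longrightarrow> v (x, t) = 0" by simp
qed

end

section \<open>Continuity and differentiability of moments\<close>

lemma continuous_on_L2_pairing:
  fixes v :: "'a::euclidean_space \<times> real \<Rightarrow> real"
  assumes "continuous_L2 I v" "L2 \<psi>"
  shows "continuous_on I (\<lambda>t. LINT x|lborel. v (x, t) * \<psi> x)"
  unfolding continuous_on_def
proof
  fix t assume t: "t \<in> I"
  have "((\<lambda>s. L2_norm (\<lambda>x. v (x, s) - v (x, t)) * L2_norm \<psi>) \<longlongrightarrow> 0) (at t within I)"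
    using assms(1) t by (intro tendsto_mult_left_zero) (auto simp: continuous_L2_def)
  moreover have "\<forall>\<^sub>F s in at t within I. norm ((LINT x|lborel. v (x, s) * \<psi> x) - (LINT x|lborel. v (x, t) * \<psi> x))
      \<le> L2_norm (\<lambda>x. v (x, s) - v (x, t)) * L2_norm \<psi>"
    unfolding eventually_at_filter
  proof (rule always_eventually, safe)
    fix s assume s: "s \<in> I"
    have L: "L2 (\<lambda>x. v (x, s))" "L2 (\<lambda>x. v (x, t))"
      using assms s t by (auto simp: continuous_L2_def)
    have "(LINT x|lborel. v (x, s) * \<psi> x) - (LINT x|lborel. v (x, t) * \<psi> x) = (LINT x|lborel. (v (x, s) - v (x, t)) * \<psi> x)"
      using L2_mult_integrable[OF L(1) assms(2)] L2_mult_integrable[OF L(2) assms(2)]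
      by (simp add: left_diff_distrib)
    then show "norm ((LINT x|lborel. v (x, s) * \<psi> x) - (LINT x|lborel. v (x, t) * \<psi> x))
      \<le> L2_norm (\<lambda>x. v (x, s) - v (x, t)) * L2_norm \<psi>"
      using L2_Cauchy_Schwarz[OF L2_diff[OF L] assms(2)] by simp
  qed
  ultimately have "((\<lambda>s. (LINT x|lborel. v (x, s) * \<psi> x) - (LINT x|lborel. v (x, t) * \<psi> x)) \<longlongrightarrow> 0) (at t within I)"
    by (rule Lim_null_comparison[rotated])
  then show "((\<lambda>s. LINT x|lborel. v (x, s) * \<psi> x) \<longlongrightarrow> (LINT x|lborel. v (x, t) * \<psi> x)) (at t within I)"
    by (simp add: LIM_zero_iff)
qed

lemma has_derivative_L2_pairing:
  fixes u v :: "'a::euclidean_space \<times> real \<Rightarrow> real"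
  assumes "continuous_L2 I u" "has_derivative_L2 I u v" "continuous_L2 I v" "L2 \<psi>" "t \<in> I"
  shows "((\<lambda>t. LINT x|lborel. u (x, t) * \<psi> x) has_real_derivative (LINT x|lborel. v (x, t) * \<psi> x)) (at t within I)"
proof -
  let ?U = "\<lambda>t. LINT x|lborel. u (x, t) * \<psi> x" and ?V = "LINT x|lborel. v (x, t) * \<psi> x"
  have "((\<lambda>s. L2_norm (\<lambda>x. (u (x, s) - u (x, t)) / (s - t) - v (x, t)) * L2_norm \<psi>) \<longlongrightarrow> 0) (at t within I)"
    using assms(2,5) by (intro tendsto_mult_left_zero) (auto simp: has_derivative_L2_def)
  moreover have "\<forall>\<^sub>F s in at t within I. norm ((?U s - ?U t) / (s - t) - ?V)
      \<le> L2_norm (\<lambda>x. (u (x, s) - u (x, t)) / (s - t) - v (x, t)) * L2_norm \<psi>"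
    unfolding eventually_at_filter
  proof (rule always_eventually, safe)
    fix s assume s: "s \<in> I"
    have L: "L2 (\<lambda>x. u (x, s))" "L2 (\<lambda>x. u (x, t))" "L2 (\<lambda>x. v (x, t))"
      using assms s by (auto simp: continuous_L2_def)
    have "L2 (\<lambda>x. inverse (s - t) * (u (x, s) - u (x, t)) - v (x, t))"
      by (intro L2_cmult L2_diff L)
    then have D: "L2 (\<lambda>x. (u (x, s) - u (x, t)) / (s - t) - v (x, t))"
      by (simp add: divide_inverse mult.commute)
    have "(?U s - ?U t) / (s - t) - ?V = (LINT x|lborel. (u (x, s) * \<psi> x - u (x, t) * \<psi> x) / (s - t) - v (x, t) * \<psi> x)"
      using L[THEN L2_mult_integrable[OF _ assms(4)]] by simp
    also have "\<dots> = (LINT x|lborel. ((u (x, s) - u (x, t)) / (s - t) - v (x, t)) * \<psi> x)"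
      by (intro Bochner_Integration.integral_cong) (auto simp: left_diff_distrib)
    finally show "norm ((?U s - ?U t) / (s - t) - ?V)
      \<le> L2_norm (\<lambda>x. (u (x, s) - u (x, t)) / (s - t) - v (x, t)) * L2_norm \<psi>"
      using L2_Cauchy_Schwarz[OF D assms(4)] by simp
  qed
  ultimately have "((\<lambda>s. (?U s - ?U t) / (s - t) - ?V) \<longlongrightarrow> 0) (at t within I)"
    by (rule Lim_null_comparison[rotated])
  then show ?thesis by (simp add: has_field_derivative_iff LIM_zero_iff)
qed

section \<open>The moment inequality\<close>

lemma exp_cutoff_nonneg: "0 \<le> exp_cutoff k r x"
proof -
  have "0 \<le> smooth_step y" for y
    unfolding smooth_step_def
    by (intro divide_nonneg_nonneg integral_nonneg bump_integrable less_imp_le[OF bump_integral_pos])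
       (auto simp: flat_nonneg)
  then show ?thesis by (simp add: exp_cutoff_def)
qed

text \<open>The constant of \<open>exp_ball_bound\<close>: an upper bound for the mass of e^(x_k) on
  the ball of radius \<open>r\<close> in dimension \<open>N\<close>.\<close>

definition ball_bound :: "nat \<Rightarrow> real \<Rightarrow> real" where
  "ball_bound N r = 2 * exp r * sqrt (4 * pi * r) ^ (N - 1)"

lemma ball_bound_pos: "0 < r \<Longrightarrow> 0 < ball_bound N r"
  by (simp add: ball_bound_def)

text \<open>This is Hoelder's inequality for the measure with density \<open>exp (x $ k)\<close> on
  the ball of radius \<open>r\<close>, obtained by integrating \<open>powr_above_tangent\<close>.
  The mass of the ball enters there with a negative sign, so an upper bound for it is enough. The
  maximum with 0 makes the claim trivial when the moment is not positive.\<close>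

lemma nonlinearity_lower_bound:
  fixes a :: "real^'n \<Rightarrow> real"
  assumes p: "1 < p" and r: "0 < r" "r \<le> r'" and a: "L2 a" "AE x in lborel. r < norm x \<longrightarrow> a x = 0"
    and int: "integrable lborel (\<lambda>x. \<bar>a x\<bar> powr p * exp_cutoff k r' x)"
  shows "max (LINT x|lborel. a x * exp_cutoff k r' x) 0 powr p / ball_bound CARD('n) r powr (p - 1)
    \<le> (LINT x|lborel. \<bar>a x\<bar> powr p * exp_cutoff k r' x)" (is "max ?V 0 powr p / ?M powr _ \<le> ?N")
proof (cases "?V \<le> 0")
  case True
  have "0 \<le> ?N"
    by (intro Bochner_Integration.integral_nonneg mult_nonneg_nonneg exp_cutoff_nonneg powr_ge_zero)
  then show ?thesis using True p by simp
next
  case False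
  \<comment> \<open>The tangent is taken at the mean value of \<open>a\<close>, computed with
    \<open>?M\<close> in place of the true mass; this choice makes the two terms combine to the
    Hoelder bound.\<close>
  define K where "K = ?V / ?M"
  have M: "0 < ?M" by (rule ball_bound_pos[OF r(1)])
  have K: "0 < K" using False M by (simp add: K_def)
  define B where "B = (\<lambda>x::real^'n. indicator (cball 0 r) x * exp (x $ k) :: real)"
  have B: "integrable lborel B" "(LINT x|lborel. B x) \<le> ?M"
    using exp_ball_bound[OF r(1), of k] by (simp_all add: B_def ball_bound_def)
  have aint: "integrable lborel (\<lambda>x. a x * exp_cutoff k r' x)"
    using r by (intro L2_mult_integrable a test_function_L2 test_function_exp_cutoff) simp
  have "K powr (p - 1) * ?V = p * (K powr (p - 1) * ?V) - (p - 1) * (K powr p * ?M)"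
  proof -
    have "K powr p = K powr (p - 1) * K" using powr_add[of K "p - 1" 1] K by simp
    then have "K powr p * ?M = K powr (p - 1) * ?V" using M by (simp add: K_def)
    then show ?thesis by (simp only:) (simp add: algebra_simps)
  qed
  also have "\<dots> \<le> p * (K powr (p - 1) * ?V) - (p - 1) * (K powr p * (LINT x|lborel. B x))"
    using B(2) p by (intro diff_left_mono mult_left_mono) auto
  also have "\<dots> = (LINT x|lborel. p * (K powr (p - 1) * (a x * exp_cutoff k r' x)) - (p - 1) * (K powr p * B x))"
    using B(1) aint by simp
  also have "\<dots> \<le> ?N"
  proof (rule integral_mono_AE)
    show "integrable lborel (\<lambda>x. p * (K powr (p - 1) * (a x * exp_cutoff k r' x)) - (p - 1) * (K powr p * B x))"
      using B(1) aint by auto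
    show "AE x in lborel. p * (K powr (p - 1) * (a x * exp_cutoff k r' x)) - (p - 1) * (K powr p * B x)
       \<le> \<bar>a x\<bar> powr p * exp_cutoff k r' x"
      using a(2)
    proof eventually_elim
      case (elim x)
      show ?case
      proof (cases "norm x \<le> r")
        case True
        have "p * (a x * K powr (p - 1)) - (p - 1) * K powr p \<le> p * (\<bar>a x\<bar> * K powr (p - 1)) - (p - 1) * K powr p"
          using p by (intro diff_right_mono mult_left_mono mult_right_mono) auto
        also have "\<dots> \<le> \<bar>a x\<bar> powr p"
          using p K by (intro powr_above_tangent) auto
        finally have "(p * (a x * K powr (p - 1)) - (p - 1) * K powr p) * exp (x $ k) \<le> \<bar>a x\<bar> powr p * exp (x $ k)"
          by (rule mult_right_mono) simp
        then show ?thesis using True r(2) by (simp add: B_def exp_cutoff_eq algebra_simps)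
      next
        case False
        then show ?thesis using elim p by (simp add: B_def)
      qed
    qed
  qed (rule int)
  also have "K powr (p - 1) * ?V = ?V powr p / ?M powr (p - 1)"
    using False M powr_add[of ?V "p - 1" 1] by (simp add: K_def powr_divide)
  finally show ?thesis using False by simp
qed

lemma time_cutoff_deriv:
  assumes "t < b" "0 \<le> s" "s \<le> t"
  shows "deriv (\<lambda>r. c * time_cutoff t b r) s = 0"
proof -
  have "\<forall>\<^sub>F r in nhds s. r \<in> {-1<..<(t + b) / 2}"
    by (rule eventually_nhds_in_open) (use assms in auto)
  then have ev: "\<forall>\<^sub>F r in nhds s. c * time_cutoff t b r = c"
    by eventually_elim (use assms time_cutoff_eq in auto)
  have "((\<lambda>r. c * time_cutoff t b r) has_real_derivative 0) (at s)"
    by (subst DERIV_cong_ev[OF refl ev refl]) simp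
  then show ?thesis by (rule DERIV_imp_deriv)
qed

lemma set_integrable_powr_mult:
  assumes "continuous_on {0..t} U" "0 \<le> (a::real)"
  shows "set_integrable lborel {0..t} (\<lambda>s. s powr a * (U s :: real))"
  unfolding set_integrable_def
proof (rule Bochner_Integration.integrable_bound)
  have U: "integrable lborel (\<lambda>s. indicator {0..t} s *\<^sub>R U s)"
    using borel_integrable_atLeastAtMost'[OF assms(1)] by (simp add: set_integrable_def)
  then show "integrable lborel (\<lambda>s. t powr a * (indicator {0..t} s *\<^sub>R U s))"
    by (rule integrable_mult_right)
  have "(\<lambda>s. s powr a * (indicator {0..t} s *\<^sub>R U s)) \<in> borel_measurable lborel"
    using borel_measurable_integrable[OF U] by (intro borel_measurable_times) auto
  then show "(\<lambda>s. indicat_real {0..t} s *\<^sub>R (s powr a * U s)) \<in> borel_measurable lborel"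
    by (simp add: mult_ac)
  show "AE s in lborel. norm (indicator {0..t} s *\<^sub>R (s powr a * U s)) \<le> norm (t powr a * (indicator {0..t} s *\<^sub>R U s))"
    using assms(2) by (intro AE_I2) (auto simp: indicator_def abs_mult intro!: mult_right_mono powr_mono2)
qed

text \<open>The weak formulation, tested with \<open>e\<^bsup>x\<^sub>k\<^esup>\<close> cut off outside the support of \<open>u\<close>. As
  \<open>\<Delta> e\<^bsup>x\<^sub>k\<^esup> = e\<^bsup>x\<^sub>k\<^esup>\<close>, it closes up to an inequality for the moments \<open>U\<close> of \<open>u\<close> and \<open>V = U'\<close>
  of \<open>u\<^sub>t\<close>.\<close>

lemma energy_solution_moments:
  fixes f g :: "real^'n \<Rightarrow> real" and u :: "(real^'n) \<times> real \<Rightarrow> real" and k :: 'n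
  assumes m: "0 \<le> m" and R: "0 < R" and p: "1 < p"
    and f: "test_function f" "supp f \<subseteq> ball 0 R" and g: "test_function g" "supp g \<subseteq> ball 0 R"
    and sol: "energy_solution m p \<epsilon> f g T u"
    and supp: "ess_supp (UNIV \<times> time_interval T) u \<subseteq> {(x, t). 0 \<le> t \<and> norm x \<le> \<xi> m t + R}"
    and \<tau>: "0 \<le> \<tau>" "ereal \<tau> < T"
  obtains U V where
    "\<And>t. t \<in> {0..\<tau>} \<Longrightarrow> (U has_real_derivative V t) (at t within {0..\<tau>})"
    "continuous_on {0..\<tau>} V"
    "U 0 = \<epsilon> * (LINT x|lborel. f x * exp (x $ k))"
    "V 0 = \<epsilon> * (LINT x|lborel. g x * exp (x $ k))"
    "\<And>t. t \<in> {0..\<tau>} \<Longrightarrow> (\<lambda>s. s powr (2 * m) * U s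
        + max (V s) 0 powr p / ball_bound CARD('n) (\<xi> m s + R) powr (p - 1)) integrable_on {0..t}"
    "\<And>t. t \<in> {0..\<tau>} \<Longrightarrow> V 0 + integral {0..t} (\<lambda>s. s powr (2 * m) * U s
        + max (V s) 0 powr p / ball_bound CARD('n) (\<xi> m s + R) powr (p - 1)) \<le> V t"
proof -
  let ?I = "time_interval T"
  obtain v w where contu: "continuous_L2 ?I u" and contw: "continuous_L2 ?I w"
    and weak: "\<And>t. t \<in> ?I \<Longrightarrow> weak_gradient (\<lambda>x. u (x, t)) (\<lambda>x. w (x, t))"
    and der: "has_derivative_L2 ?I u v" and contv: "continuous_L2 ?I v"
    and u0: "AE x in lborel. u (x, 0) = \<epsilon> * f x" and v0: "AE x in lborel. v (x, 0) = \<epsilon> * g x"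
    and eqs: "\<forall>\<Phi>. spacetime_test_function T \<Phi> \<longrightarrow> (\<forall>t\<in>?I.
        set_integrable lborel (UNIV \<times> {0..t}) (\<lambda>z. \<bar>v z\<bar> powr p * \<Phi> z) \<and>
        (LINT x|lborel. v (x, t) * \<Phi> (x, t))
          - (LINT x|lborel. v (x, 0) * \<Phi> (x, 0))
          - (LINT s:{0..t}|lborel. (LINT x|lborel. v (x, s) * deriv (\<lambda>r. \<Phi> (x, r)) s))
          + (LINT s:{0..t}|lborel.
               s powr (2 * m) * (LINT x|lborel. w (x, s) \<bullet> grad (\<lambda>y. \<Phi> (y, s)) x))
        = (LINT s:{0..t}|lborel. (LINT x|lborel. \<bar>v (x, s)\<bar> powr p * \<Phi> (x, s))))"
    using sol unfolding energy_solution_def by blast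
  have I: "{0..\<tau>} \<subseteq> ?I"
    using \<tau> by (auto simp: time_interval_def intro: le_less_trans[of "ereal _" "ereal \<tau>"])
  \<comment> \<open>The margin 1 keeps the support of \<open>u\<close> strictly inside the ball on
    which the cutoff is 1, as \<open>laplacian_exp_cutoff\<close> requires.\<close>
  define r where "r = \<xi> m \<tau> + R + 1"
  have r: "0 \<le> r" using \<xi>_nonneg[OF m, of \<tau>] R by (simp add: r_def)
  have r_ge: "\<xi> m s + R < r" if "s \<in> {0..\<tau>}" for s
    using \<xi>_mono[OF m, of s \<tau>] that by (simp add: r_def)
  define \<Psi> where "\<Psi> = exp_cutoff k r"
  have \<Psi>: "test_function \<Psi>" unfolding \<Psi>_def by (rule test_function_exp_cutoff[OF r])
  note L2\<Psi> = test_function_L2[OF \<Psi>]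
  define U where "U = (\<lambda>t. LINT x|lborel. u (x, t) * \<Psi> x)"
  define V where "V = (\<lambda>t. LINT x|lborel. v (x, t) * \<Psi> x)"
  define n where "n = (\<lambda>s. max (V s) 0 powr p / ball_bound CARD('n) (\<xi> m s + R) powr (p - 1))"
  have derU: "(U has_real_derivative V t) (at t within {0..\<tau>})" if "t \<in> {0..\<tau>}" for t
    unfolding U_def V_def
    by (rule DERIV_subset[OF has_derivative_L2_pairing[OF contu der contv L2\<Psi>] I]) (use that I in auto)
  have cV: "continuous_on {0..\<tau>} V"
    unfolding V_def by (rule continuous_on_subset[OF continuous_on_L2_pairing[OF contv L2\<Psi>] I])
  have cU: "continuous_on {0..\<tau>} U"
    unfolding U_def by (rule continuous_on_subset[OF continuous_on_L2_pairing[OF contu L2\<Psi>] I])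
  have init: "(LINT x|lborel. y x * \<Psi> x) = \<epsilon> * (LINT x|lborel. h x * exp (x $ k))"
    if "AE x in lborel. y x = \<epsilon> * h x" "test_function h" "supp h \<subseteq> ball 0 R" "L2 y" for y h
  proof -
    have "(LINT x|lborel. y x * \<Psi> x) = (LINT x|lborel. \<epsilon> * (h x * exp (x $ k)))"
    proof (rule integral_cong_AE)
      show "(\<lambda>x. y x * \<Psi> x) \<in> borel_measurable lborel"
        using that(4) L2\<Psi> by (auto simp: L2_def)
      have "h \<in> borel_measurable lborel" using test_function_L2[OF that(2)] by (simp add: L2_def)
      moreover have "(\<lambda>x::real^'n. exp (x $ k)) \<in> borel_measurable lborel"
        by (auto intro!: borel_measurable_continuous_onI continuous_intros)
      ultimately show "(\<lambda>x. \<epsilon> * (h x * exp (x $ k))) \<in> borel_measurable lborel"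
        by simp
      show "AE x in lborel. y x * \<Psi> x = \<epsilon> * (h x * exp (x $ k))"
        using that(1)
      proof eventually_elim
        case (elim x)
        show ?case
        proof (cases "x \<in> ball 0 R")
          case True
          then show ?thesis using r_ge[of 0] \<xi>_nonneg[OF m, of 0] \<tau> elim by (simp add: \<Psi>_def exp_cutoff_eq)
        next
          case False
          then have "h x = 0" using that(3) by (intro not_in_supp) blast
          then show ?thesis using elim by simp
        qed
      qed
    qed
    then show ?thesis by simp
  qed
  have I0: "0 \<in> ?I" using I \<tau> by auto
  have U0: "U 0 = \<epsilon> * (LINT x|lborel. f x * exp (x $ k))"
    unfolding U_def by (rule init[OF u0 f]) (use contu I0 in \<open>simp add: continuous_L2_def\<close>)
  have V0: "V 0 = \<epsilon> * (LINT x|lborel. g x * exp (x $ k))"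
    unfolding V_def by (rule init[OF v0 g]) (use contv I0 in \<open>simp add: continuous_L2_def\<close>)

  \<comment> \<open>The equation closes here. \<open>\<Psi>\<close> equals its own Laplacian only
    inside the ball of radius \<open>r\<close>, but outside it \<open>u\<close> vanishes almost
    everywhere.\<close>
  have dirichlet: "(LINT x|lborel. w (x, s) \<bullet> grad \<Psi> x) = - U s" if s: "s \<in> {0..\<tau>}" for s
  proof -
    have sI: "s \<in> ?I" using s I by auto
    have "(LINT x|lborel. w (x, s) \<bullet> grad \<Psi> x) = - (LINT x|lborel. u (x, s) * laplacian \<Psi> x)"
      by (rule weak_gradient_laplacian[OF weak[OF sI] _ _ \<Psi>])
         (use contu contw sI in \<open>auto simp: continuous_L2_def\<close>)
    also have "(LINT x|lborel. u (x, s) * laplacian \<Psi> x) = U s"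
      unfolding U_def
    proof (rule integral_cong_AE)
      have um: "(\<lambda>x. u (x, s)) \<in> borel_measurable lborel"
        using contu sI by (auto simp: continuous_L2_def L2_def)
      show "(\<lambda>x. u (x, s) * \<Psi> x) \<in> borel_measurable lborel"
        using um L2\<Psi> by (auto simp: L2_def)
      have "laplacian \<Psi> \<in> borel_measurable lborel"
        unfolding laplacian_def[abs_def]
        using test_function_L2[OF test_function_frechet_derivative[OF test_function_frechet_derivative[OF \<Psi>]]]
        by (intro borel_measurable_sum) (auto simp: L2_def)
      then show "(\<lambda>x. u (x, s) * laplacian \<Psi> x) \<in> borel_measurable lborel"
        using um by simp
      show "AE x in lborel. u (x, s) * laplacian \<Psi> x = u (x, s) * \<Psi> x"
        using solution_support[OF m contu supp sI]
      proof eventually_elim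
        case (elim x)
        then show ?case
          using r_ge[OF s] laplacian_exp_cutoff[of x r k] exp_cutoff_eq[of x r k]
          by (cases "\<xi> m s + R < norm x") (auto simp: \<Psi>_def)
      qed
    qed
    finally show ?thesis .
  qed

  \<comment> \<open>The strict inequality \<open>\<tau> < T\<close> leaves room for the time cutoff
    to descend to 0 before \<open>T\<close>.\<close>
  obtain b where b: "\<tau> < b" "ereal b < T"
    using ereal_dense2[OF \<tau>(2)] by auto
  define \<Phi> where "\<Phi> = (\<lambda>z. \<Psi> (fst z) * time_cutoff \<tau> b (snd z))"
  have \<Phi>: "spacetime_test_function T \<Phi>"
    unfolding \<Phi>_def \<Psi>_def by (rule spacetime_cutoff[OF b r])
  have \<Phi>_eq: "\<Phi> (x, s) = \<Psi> x" if "s \<in> {0..\<tau>}" for x s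
    using that b by (simp add: \<Phi>_def time_cutoff_eq)

  define N where "N = (\<lambda>s. LINT x|lborel. \<bar>v (x, s)\<bar> powr p * \<Psi> x)"
  have main: "(\<lambda>s. s powr (2 * m) * U s + n s) integrable_on {0..t} \<and>
     V 0 + integral {0..t} (\<lambda>s. s powr (2 * m) * U s + n s) \<le> V t" if t: "t \<in> {0..\<tau>}" for t
  proof -
    have tI: "t \<in> ?I" using t I by auto
    have sub: "s \<in> {0..\<tau>}" if "s \<in> {0..t}" for s using that t by auto
    have intPhi: "set_integrable lborel (UNIV \<times> {0..t}) (\<lambda>z. \<bar>v z\<bar> powr p * \<Phi> z)"
      and weak_eq: "(LINT x|lborel. v (x, t) * \<Phi> (x, t))
          - (LINT x|lborel. v (x, 0) * \<Phi> (x, 0))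
          - (LINT s:{0..t}|lborel. (LINT x|lborel. v (x, s) * deriv (\<lambda>r. \<Phi> (x, r)) s))
          + (LINT s:{0..t}|lborel.
               s powr (2 * m) * (LINT x|lborel. w (x, s) \<bullet> grad (\<lambda>y. \<Phi> (y, s)) x))
        = (LINT s:{0..t}|lborel. (LINT x|lborel. \<bar>v (x, s)\<bar> powr p * \<Phi> (x, s)))"
      using eqs \<Phi> tI by blast+
    have e1: "(LINT x|lborel. v (x, t) * \<Phi> (x, t)) = V t" "(LINT x|lborel. v (x, 0) * \<Phi> (x, 0)) = V 0"
      using t by (simp_all add: V_def \<Phi>_eq)
    have e2: "(LINT s:{0..t}|lborel. (LINT x|lborel. v (x, s) * deriv (\<lambda>r. \<Phi> (x, r)) s)) = 0"
    proof -
      have "(LINT s:{0..t}|lborel. (LINT x|lborel. v (x, s) * deriv (\<lambda>r. \<Phi> (x, r)) s))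
         = (LINT s:{0..t}|lborel. (0::real))"
      proof (rule set_lebesgue_integral_cong, simp, intro allI impI)
        fix s assume s: "s \<in> {0..t}"
        have "deriv (\<lambda>r. \<Phi> (x, r)) s = 0" for x
          using time_cutoff_deriv[OF b(1), of s "\<Psi> x"] sub[OF s] by (simp add: \<Phi>_def)
        then show "(LINT x|lborel. v (x, s) * deriv (\<lambda>r. \<Phi> (x, r)) s) = 0" by simp
      qed
      then show ?thesis by simp
    qed
    have e3: "(LINT s:{0..t}|lborel. s powr (2 * m) * (LINT x|lborel. w (x, s) \<bullet> grad (\<lambda>y. \<Phi> (y, s)) x))
        = (LINT s:{0..t}|lborel. - (s powr (2 * m) * U s))"
    proof (rule set_lebesgue_integral_cong, simp, intro allI impI)
      fix s assume s: "s \<in> {0..t}"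
      have "(\<lambda>y. \<Phi> (y, s)) = \<Psi>" using \<Phi>_eq[OF sub[OF s]] by auto
      then show "s powr (2 * m) * (LINT x|lborel. w (x, s) \<bullet> grad (\<lambda>y. \<Phi> (y, s)) x) = - (s powr (2 * m) * U s)"
        using dirichlet[OF sub[OF s]] by simp
    qed
    have e4: "(LINT s:{0..t}|lborel. (LINT x|lborel. \<bar>v (x, s)\<bar> powr p * \<Phi> (x, s))) = (LINT s:{0..t}|lborel. N s)"
      by (rule set_lebesgue_integral_cong) (auto simp: N_def \<Phi>_eq[OF sub])

    \<comment> \<open>The joint integrability contained in \<open>energy_solution\<close> admits
      Fubini's theorem: almost every slice is integrable, so \<open>nonlinearity_lower_bound\<close>
      applies to it, and \<open>N\<close> is integrable in time.\<close>
    have "integrable (lborel \<Otimes>\<^sub>M lborel) (\<lambda>(x, s). indicator {0..t} s * (\<bar>v (x, s)\<bar> powr p * \<Psi> x))"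
    proof -
      have "integrable lborel (\<lambda>z. indicator (UNIV \<times> {0..t}) z *\<^sub>R (\<bar>v z\<bar> powr p * \<Phi> z))"
        using intPhi by (simp add: set_integrable_def)
      also have "(\<lambda>z. indicator (UNIV \<times> {0..t}) z *\<^sub>R (\<bar>v z\<bar> powr p * \<Phi> z)) =
         (\<lambda>(x, s). indicator {0..t} s * (\<bar>v (x, s)\<bar> powr p * \<Psi> x))"
        using \<Phi>_eq[OF sub] by (auto simp: fun_eq_iff indicator_def)
      finally show ?thesis unfolding lborel_prod .
    qed
    note fub = lborel_pair.AE_integrable_snd[OF this] lborel_pair.integrable_snd[OF this]
    have N_int: "set_integrable lborel {0..t} N"
      using fub(2) by (simp add: set_integrable_def N_def)
    have n_cont: "continuous_on {0..t} n"
    proof -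
      have cx: "continuous_on {0..t} (\<lambda>s. \<xi> m s + R)"
        by (intro continuous_intros continuous_on_subset[OF continuous_on_\<xi>[OF m]]) auto
      have pos: "0 < \<xi> m s + R" for s using \<xi>_nonneg[OF m, of s] R by simp
      have "continuous_on {0..t} (\<lambda>s. max (V s) 0 powr p)"
        using p by (intro continuous_on_powr' continuous_intros continuous_on_subset[OF cV]) (use t in auto)
      moreover have "continuous_on {0..t} (\<lambda>s. ball_bound CARD('n) (\<xi> m s + R))"
        unfolding ball_bound_def using cx by (auto intro!: continuous_intros)
      then have "continuous_on {0..t} (\<lambda>s. ball_bound CARD('n) (\<xi> m s + R) powr (p - 1))"
        using ball_bound_pos[OF pos, where N="CARD('n)"]
        by (intro continuous_on_powr continuous_on_const) (auto simp: less_imp_neq[THEN not_sym])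
      ultimately show ?thesis
        unfolding n_def using ball_bound_pos[OF pos, where N="CARD('n)"]
        by (intro continuous_on_divide) (auto simp: less_imp_neq[THEN not_sym])
    qed
    have n_int: "set_integrable lborel {0..t} n"
      by (rule borel_integrable_atLeastAtMost'[OF n_cont])
    have "(LINT s:{0..t}|lborel. n s) \<le> (LINT s:{0..t}|lborel. N s)"
      unfolding set_lebesgue_integral_def
    proof (rule integral_mono_AE)
      show "integrable lborel (\<lambda>s. indicator {0..t} s *\<^sub>R n s)" "integrable lborel (\<lambda>s. indicator {0..t} s *\<^sub>R N s)"
        using n_int N_int by (simp_all add: set_integrable_def)
      show "AE s in lborel. indicator {0..t} s *\<^sub>R n s \<le> indicator {0..t} s *\<^sub>R N s"
        using fub(1)
      proof eventually_elim
        case (elim s)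
        show ?case
        proof (cases "s \<in> {0..t}")
          case True
          have sI: "s \<in> ?I" using sub[OF True] I by auto
          have "n s \<le> N s"
            unfolding n_def N_def V_def \<Psi>_def
          proof (rule nonlinearity_lower_bound[OF p])
            show "0 < \<xi> m s + R" using \<xi>_nonneg[OF m, of s] R by simp
            show "\<xi> m s + R \<le> r" using r_ge[OF sub[OF True]] by simp
            show "L2 (\<lambda>x. v (x, s))" using contv sI by (simp add: continuous_L2_def)
            show "AE x in lborel. \<xi> m s + R < norm x \<longrightarrow> v (x, s) = 0"
              by (rule time_derivative_support[OF m contu supp sI der contv])
            show "integrable lborel (\<lambda>x. \<bar>v (x, s)\<bar> powr p * exp_cutoff k r x)"
              using elim True by (simp add: \<Psi>_def)
          qed
          then show ?thesis using True by simp
        qed simp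
      qed
    qed
    moreover have U_int: "set_integrable lborel {0..t} (\<lambda>s. s powr (2 * m) * U s)"
      by (rule set_integrable_powr_mult) (use m t in \<open>auto intro: continuous_on_subset[OF cU]\<close>)
    moreover have "V t - V 0 - (LINT s:{0..t}|lborel. s powr (2 * m) * U s) = (LINT s:{0..t}|lborel. N s)"
      using weak_eq e1 e2 e3 e4 by (simp add: set_integral_uminus[OF U_int])
    moreover have "(LINT s:{0..t}|lborel. s powr (2 * m) * U s + n s)
        = (LINT s:{0..t}|lborel. s powr (2 * m) * U s) + (LINT s:{0..t}|lborel. n s)"
      by (rule set_integral_add(2)[OF U_int n_int])
    ultimately have "V 0 + (LINT s:{0..t}|lborel. s powr (2 * m) * U s + n s) \<le> V t" by simp
    then show ?thesis
      using set_borel_integral_eq_integral[OF set_integral_add(1)[OF U_int n_int]] by simp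
  qed
  show ?thesis
    by (rule that[OF derU cV U0 V0]) (use main in \<open>auto simp: n_def\<close>)
qed

section \<open>Comparison for the ordinary differential inequality\<close>

lemma deriv_nonneg_mono:
  fixes F :: "real \<Rightarrow> real"
  assumes der: "\<And>t. t \<in> {a..b} \<Longrightarrow> (F has_real_derivative F' t) (at t within {a..b})"
    and nonneg: "\<And>t. t \<in> {a..b} \<Longrightarrow> 0 \<le> F' t" and t: "t \<in> {a..b}"
  shows "F a \<le> F t"
proof (rule DERIV_nonneg_imp_increasing_open[where f = F])
  show "a \<le> t" using t by simp
  show "continuous_on {a..t} F"
    by (rule continuous_on_subset[OF DERIV_continuous_on[OF der]]) (use t in auto)
  fix x assume x: "a < x" "x < t"
  then have "at x within {a..b} = at x" using t by (intro at_within_Icc_at) auto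
  then show "\<exists>y. (F has_real_derivative y) (at x) \<and> 0 \<le> y"
    using der[of x] nonneg[of x] x t by auto
qed

text \<open>First-zero argument: before the first time \<open>z\<close> with
  \<open>V z \<le> 0\<close> the function \<open>U\<close> is nondecreasing, hence nonnegative on
  \<open>{0..z}\<close>. The integral inequality then gives \<open>V z \<ge> V\<^sub>0 > 0\<close>,
  a contradiction.\<close>

lemma moments_positive:
  fixes U V n :: "real \<Rightarrow> real"
  assumes der: "\<And>t. t \<in> {0..\<tau>} \<Longrightarrow> (U has_real_derivative V t) (at t within {0..\<tau>})"
    and cont: "continuous_on {0..\<tau>} V"
    and init: "0 \<le> U 0" "0 < V\<^sub>0" and n: "\<And>s. 0 \<le> n s"
    and int: "\<And>t. t \<in> {0..\<tau>} \<Longrightarrow> (\<lambda>s. s powr a * U s + n s) integrable_on {0..t}"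
    and ineq: "\<And>t. t \<in> {0..\<tau>} \<Longrightarrow> V\<^sub>0 + integral {0..t} (\<lambda>s. s powr a * U s + n s) \<le> V t"
    and t: "t \<in> {0..\<tau>}"
  shows "0 \<le> U t" "V\<^sub>0 \<le> V t"
proof -
  have cU: "continuous_on {0..\<tau>} U" by (rule DERIV_continuous_on[OF der])
  have U: "0 \<le> U s" if s: "s \<in> {0..\<tau>}" and V: "\<And>x. 0 \<le> x \<Longrightarrow> x < s \<Longrightarrow> 0 < V x" for s
  proof -
    have "U 0 \<le> U s"
    proof (rule DERIV_nonneg_imp_increasing_open[where f = U])
      show "continuous_on {0..s} U" by (rule continuous_on_subset[OF cU]) (use s in auto)
      fix x assume x: "0 < x" "x < s"
      then have "at x within {0..\<tau>} = at x" using s by (intro at_within_Icc_at) auto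
      then show "\<exists>y. (U has_real_derivative y) (at x) \<and> 0 \<le> y"
        using der[of x] V[of x] x s by force
    qed (use s in auto)
    then show ?thesis using init by simp
  qed
  have V: "V\<^sub>0 \<le> V s" if s: "s \<in> {0..\<tau>}" and pos: "\<And>x. x \<in> {0..s} \<Longrightarrow> 0 \<le> U x" for s
  proof -
    have "0 \<le> integral {0..s} (\<lambda>s. s powr a * U s + n s)"
      using pos n by (intro integral_nonneg int s) auto
    then show ?thesis using ineq[OF s] by simp
  qed
  have pos: "0 < V s" if s: "s \<in> {0..\<tau>}" for s
  proof (rule ccontr)
    assume neg: "\<not> 0 < V s"
    define Z where "Z = {x \<in> {0..\<tau>}. V x \<le> 0}"
    have "Z = {0..\<tau>} \<inter> V -` {..0}" by (auto simp: Z_def)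
    then have "closed Z" using continuous_closed_preimage[OF cont, of "{..0}"] by simp
    then have "compact ({0..\<tau>} \<inter> Z)" by (intro compact_Int_closed compact_Icc)
    moreover have "{0..\<tau>} \<inter> Z = Z" by (auto simp: Z_def)
    ultimately have "compact Z" by simp
    moreover have "s \<in> Z" using s neg by (auto simp: Z_def)
    ultimately obtain z where z: "z \<in> Z" "\<And>x. x \<in> Z \<Longrightarrow> z \<le> x"
      using compact_attains_inf[of Z] by auto
    have before: "0 < V x" if "0 \<le> x" "x < z" for x
      using z(2)[of x] z(1) that by (force simp: Z_def)
    have "V\<^sub>0 \<le> V z"
    proof (rule V)
      show "z \<in> {0..\<tau>}" using z by (simp add: Z_def)
      fix x assume "x \<in> {0..z}"
      then show "0 \<le> U x" using before z(1) by (intro U) (auto simp: Z_def)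
    qed
    then show False using z(1) init by (simp add: Z_def)
  qed
  show "0 \<le> U t" using pos t by (intro U) auto
  show "V\<^sub>0 \<le> V t"
    by (rule V[OF t]) (use pos t in \<open>auto intro!: U\<close>)
qed

text \<open>Passing to integrals of continuous lower bounds makes the moment inequality a
  differential inequality between \<open>C\<^sup>1\<close> functions; \<open>V\<close> itself is only absolutely continuous.\<close>

lemma moments_C1_minorant:
  fixes U V n :: "real \<Rightarrow> real"
  assumes der: "\<And>t. t \<in> {0..\<tau>} \<Longrightarrow> (U has_real_derivative V t) (at t within {0..\<tau>})"
    and cont: "continuous_on {0..\<tau>} V"
    and init: "0 \<le> U 0" "0 < V\<^sub>0" and n: "\<And>s. 0 \<le> n s"
    and int: "\<And>t. t \<in> {0..\<tau>} \<Longrightarrow> (\<lambda>s. s powr e * U s + n s) integrable_on {0..t}"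
    and ineq: "\<And>t. t \<in> {0..\<tau>} \<Longrightarrow> V\<^sub>0 + integral {0..t} (\<lambda>s. s powr e * U s + n s) \<le> V t"
    and a: "0 < a" "a \<le> \<tau>" and p: "1 < (p::real)"
    and \<gamma>: "continuous_on {a..\<tau>} \<gamma>" "\<And>s. s \<in> {a..\<tau>} \<Longrightarrow> 0 \<le> \<gamma> s"
      "\<And>s. s \<in> {a..\<tau>} \<Longrightarrow> 0 < V s \<Longrightarrow> \<gamma> s * V s powr p \<le> n s"
  obtains X W W' where
    "\<And>t. t \<in> {a..\<tau>} \<Longrightarrow> (X has_real_derivative W t) (at t within {a..\<tau>})"
    "\<And>t. t \<in> {a..\<tau>} \<Longrightarrow> (W has_real_derivative W' t) (at t within {a..\<tau>})"
    "\<And>t. t \<in> {a..\<tau>} \<Longrightarrow> t powr e * X t + \<gamma> t * W t powr p \<le> W' t"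
    "\<And>t. t \<in> {a..\<tau>} \<Longrightarrow> 0 \<le> X t" "\<And>t. t \<in> {a..\<tau>} \<Longrightarrow> V\<^sub>0 \<le> W t" "X a = 0" "W a = V\<^sub>0"
proof -
  have pos: "0 \<le> U t" "V\<^sub>0 \<le> V t" if "t \<in> {0..\<tau>}" for t
    by (rule moments_positive[OF der cont init n int ineq that]; assumption)+
  have sub: "t \<in> {0..\<tau>}" if "t \<in> {a..\<tau>}" for t using that a by auto
  have subset: "{a..\<tau>} \<subseteq> {0..\<tau>}" using a by auto
  have Vpos: "0 < V t" if "t \<in> {a..\<tau>}" for t
    using pos(2)[OF sub[OF that]] init by simp
  \<comment> \<open>\<open>h\<close> is continuous, so its primitive \<open>W\<close> is
    continuously differentiable. It still contains \<open>U\<close> and \<open>V\<close>; these are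
    exchanged for the smaller \<open>X\<close> and \<open>W\<close> only at the end, by
    monotonicity.\<close>
  define h where "h = (\<lambda>s. s powr e * U s + \<gamma> s * V s powr p)"
  have cV: "continuous_on {a..\<tau>} V" by (rule continuous_on_subset[OF cont subset])
  have cU: "continuous_on {a..\<tau>} U"
    by (rule continuous_on_subset[OF DERIV_continuous_on[OF der] subset])
  have h: "continuous_on {a..\<tau>} h"
    unfolding h_def using Vpos a by (intro continuous_intros cU cV \<gamma>(1)) (auto simp: less_imp_neq[THEN not_sym])
  define W where "W = (\<lambda>t. V\<^sub>0 + integral {a..t} h)"
  have derW: "(W has_real_derivative h t) (at t within {a..\<tau>})" if "t \<in> {a..\<tau>}" for t
    unfolding W_def using integral_has_real_derivative[OF h that] by (auto intro!: derivative_eq_intros)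
  have cW: "continuous_on {a..\<tau>} W" by (rule DERIV_continuous_on[OF derW])
  define X where "X = (\<lambda>t. integral {a..t} W)"
  have derX: "(X has_real_derivative W t) (at t within {a..\<tau>})" if "t \<in> {a..\<tau>}" for t
    unfolding X_def using integral_has_real_derivative[OF cW that] .
  have hpos: "0 \<le> h t" if "t \<in> {a..\<tau>}" for t
    unfolding h_def using pos(1)[OF sub[OF that]] \<gamma>(2)[OF that] by simp
  have Wa: "W a = V\<^sub>0" and Xa: "X a = 0" by (simp_all add: W_def X_def)
  have W0: "V\<^sub>0 \<le> W t" if "t \<in> {a..\<tau>}" for t
  proof -
    have "W a \<le> W t" by (rule deriv_nonneg_mono[OF derW hpos that])
    then show ?thesis using Wa by simp
  qed
  have X0: "0 \<le> X t" if "t \<in> {a..\<tau>}" for t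
  proof -
    have "X a \<le> X t"
      by (rule deriv_nonneg_mono[OF derX _ that]) (use W0 init in force)+
    then show ?thesis using Xa by simp
  qed
  have WV: "W t \<le> V t" if t: "t \<in> {a..\<tau>}" for t
  proof -
    let ?H = "\<lambda>s. s powr e * U s + n s"
    have I: "?H integrable_on {0..t}" by (rule int[OF sub[OF t]])
    have Ia: "?H integrable_on {a..t}" and I0: "?H integrable_on {0..a}"
      by (rule integrable_on_subinterval[OF I]; use a t in auto)+
    have "integral {a..t} h \<le> integral {a..t} ?H"
    proof (rule integral_le[OF _ Ia])
      show "h integrable_on {a..t}"
        by (rule integrable_continuous_interval[OF continuous_on_subset[OF h]]) (use t in auto)
      show "h s \<le> ?H s" if "s \<in> {a..t}" for s
        using \<gamma>(3)[of s] Vpos[of s] that t by (auto simp: h_def)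
    qed
    \<comment> \<open>Whatever accumulates before time \<open>a\<close> is dropped, so that
      \<open>W\<close> starts from \<open>V\<^sub>0\<close> there.\<close>
    moreover have "0 \<le> integral {0..a} ?H"
      using pos(1) n a by (intro integral_nonneg I0) auto
    moreover have "integral {0..a} ?H + integral {a..t} ?H = integral {0..t} ?H"
      by (rule Henstock_Kurzweil_Integration.integral_combine) (use a t I in auto)
    ultimately show ?thesis using ineq[OF sub[OF t]] by (simp add: W_def)
  qed
  have XU: "X t \<le> U t" if t: "t \<in> {a..\<tau>}" for t
  proof -
    have "U a - X a \<le> U t - X t"
    proof (rule deriv_nonneg_mono[OF _ _ t])
      fix s assume s: "s \<in> {a..\<tau>}"
      show "((\<lambda>s. U s - X s) has_real_derivative V s - W s) (at s within {a..\<tau>})"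
        by (intro DERIV_diff derX s DERIV_subset[OF der[OF sub[OF s]] subset])
      show "0 \<le> V s - W s" using WV[OF s] by simp
    qed
    moreover have "0 \<le> U a" using pos(1) a by auto
    ultimately show ?thesis using Xa by simp
  qed
  show ?thesis
  proof (rule that[of X W h, OF derX derW _ X0 W0 Xa Wa])
    fix t assume t: "t \<in> {a..\<tau>}"
    have "t powr e * X t + \<gamma> t * W t powr p \<le> t powr e * U t + \<gamma> t * V t powr p"
      using XU[OF t] WV[OF t] W0[OF t] init \<gamma>(2)[OF t] p
      by (intro add_mono mult_left_mono powr_mono2) auto
    then show "t powr e * X t + \<gamma> t * W t powr p \<le> h t" by (simp add: h_def)
  qed auto
qed

text \<open>\<open>wkb\<close> is a decaying supersolution of \<open>\<rho>'' = t\<^bsup>2m\<^esup> \<rho>\<close> for large \<open>t\<close>: the WKB approximation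
  \<open>t\<^bsup>-m/2\<^esup> exp (- \<xi> t)\<close> with a correction factor tending to \<open>1\<close>. Its logarithmic derivative
  is \<open>wkb_log\<close>.\<close>

definition wkb_log :: "real \<Rightarrow> real \<Rightarrow> real" where
  "wkb_log m t = - (t powr m) - m / (2 * t) + m * (m + 2) / 8 / (t powr m * t\<^sup>2)"

definition wkb_log_deriv :: "real \<Rightarrow> real \<Rightarrow> real" where
  "wkb_log_deriv m t = - m * t powr m / t + m / (2 * t\<^sup>2) - m * (m + 2) / 8 * (m + 2) / (t powr m * t ^ 3)"

definition wkb :: "real \<Rightarrow> real \<Rightarrow> real" where
  "wkb m t = exp (- \<xi> m t - m / 2 * ln t - m * (m + 2) / (8 * (m + 1)) / (t powr m * t))"

section \<open>Derivatives and bounds of the WKB supersolution\<close>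

lemma powr_has_derivative: "0 < t \<Longrightarrow> ((\<lambda>t. t powr m) has_real_derivative m * t powr m / t) (at t)"
  using has_real_derivative_powr[of t m] by (simp add: powr_diff)

lemma \<xi>_has_derivative: "0 \<le> m \<Longrightarrow> 0 < t \<Longrightarrow> (\<xi> m has_real_derivative t powr m) (at t)"
  unfolding \<xi>_def[abs_def]
  using DERIV_cdivide[OF has_real_derivative_powr[of t "m + 1"], of "m + 1"] by simp

lemma DERIV_const_divide:
  assumes "(B has_real_derivative B') (at t)" "B t \<noteq> 0"
  shows "((\<lambda>t. k / B t) has_real_derivative - (k * B' / (B t)\<^sup>2)) (at t)"
  using DERIV_divide[OF DERIV_const assms(1,2), of k] by (simp add: power2_eq_square)

lemma wkb_log_has_derivative:
  assumes "0 < t"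
  shows "(wkb_log m has_real_derivative wkb_log_deriv m t) (at t)"
proof -
  have ne: "t powr m * t\<^sup>2 \<noteq> 0" using assms by simp
  have "((\<lambda>t. t powr m * t\<^sup>2) has_real_derivative (m + 2) * t powr m * t) (at t)"
    using DERIV_mult[OF powr_has_derivative[OF assms, of m] DERIV_power[OF DERIV_ident, where n = 2]] assms
    by (simp add: algebra_simps power2_eq_square)
  from DERIV_const_divide[OF this ne, of "m * (m + 2) / 8"]
  have 1: "((\<lambda>t. m * (m + 2) / 8 / (t powr m * t\<^sup>2)) has_real_derivative
      - (m * (m + 2) / 8 * ((m + 2) * t powr m * t) / (t powr m * t\<^sup>2)\<^sup>2)) (at t)" .
  have e: "m * (m + 2) / 8 * ((m + 2) * t powr m * t) / (t powr m * t\<^sup>2)\<^sup>2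
      = m * (m + 2) / 8 * (m + 2) / (t powr m * t ^ 3)"
  proof -
    have "k * (x * t) / (x * t\<^sup>2)\<^sup>2 = k / (x * t ^ 3)" if "x \<noteq> 0" for k x :: real
      using that assms by (simp add: field_simps power2_eq_square power3_eq_cube)
    from this[of "t powr m" "m * (m + 2) / 8 * (m + 2)"] show ?thesis
      using assms by (simp add: mult.assoc)
  qed
  have 2: "((\<lambda>t. m / (2 * t)) has_real_derivative - (m / (2 * t\<^sup>2))) (at t)"
    using assms by (auto intro!: derivative_eq_intros simp: power2_eq_square)
  from DERIV_add[OF DERIV_diff[OF DERIV_minus[OF powr_has_derivative[OF assms, of m]] 2] 1[unfolded e]]
  show ?thesis by (simp add: wkb_log_def[abs_def] wkb_log_deriv_def)
qed

lemma wkb_has_derivative: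
  assumes "0 < t" "0 \<le> m"
  shows "(wkb m has_real_derivative wkb_log m t * wkb m t) (at t)"
proof -
  have x: "0 < t powr m" using assms by simp
  have E: "((\<lambda>t. - \<xi> m t - m / 2 * ln t - m * (m + 2) / (8 * (m + 1)) / (t powr m * t))
      has_real_derivative wkb_log m t) (at t)"
  proof -
    have "((\<lambda>t. t powr m * t) has_real_derivative (m + 1) * t powr m) (at t)"
      using DERIV_mult[OF powr_has_derivative[OF assms(1), of m] DERIV_ident] assms(1)
      by (simp add: algebra_simps)
    from DERIV_const_divide[OF this, of "m * (m + 2) / (8 * (m + 1))"]
    have 1: "((\<lambda>t. m * (m + 2) / (8 * (m + 1)) / (t powr m * t)) has_real_derivative
        - (m * (m + 2) / (8 * (m + 1)) * ((m + 1) * t powr m) / (t powr m * t)\<^sup>2)) (at t)"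
      using assms by simp
    have e: "m * (m + 2) / (8 * (m + 1)) * ((m + 1) * t powr m) / (t powr m * t)\<^sup>2
        = m * (m + 2) / 8 / (t powr m * t\<^sup>2)"
    proof -
      have "k / (8 * n) * (n * x) / (x * t)\<^sup>2 = k / 8 / (x * t\<^sup>2)" if "x \<noteq> 0" "n \<noteq> 0" for k x n :: real
        using that assms by (simp add: field_simps power2_eq_square)
      from this[of "t powr m" "m + 1" "m * (m + 2)"] show ?thesis using assms by simp
    qed
    have 2: "((\<lambda>t. m / 2 * ln t) has_real_derivative m / (2 * t)) (at t)"
      using assms by (auto intro!: derivative_eq_intros)
    from DERIV_diff[OF DERIV_diff[OF DERIV_minus[OF \<xi>_has_derivative[OF assms(2,1)]] 2] 1[unfolded e]]
    show ?thesis by (simp add: wkb_log_def)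
  qed
  from DERIV_chain2[OF DERIV_exp E] show ?thesis
    by (simp add: wkb_def[abs_def] mult.commute)
qed

text \<open>For \<open>\<rho> = wkb m\<close> and \<open>q = wkb_log m\<close> one has
  \<rho>''/\<rho> = q' + q^2, so the third claim is the supersolution property in Riccati form. The
  threshold on \<open>t\<close> ensures \<open>1 \<le> t\<close> and that the correction
  \<open>c / (x * t)\<close> is at most 1.\<close>

lemma wkb_log_bounds:
  assumes m: "0 \<le> m" and t: "1 + m * (m + 2) \<le> t"
  shows "wkb_log m t \<le> 0" "- wkb_log m t \<le> (m + 1) * t powr m"
    "wkb_log_deriv m t + (wkb_log m t)\<^sup>2 \<le> t powr (2 * m)"
proof -
  define x where "x = t powr m"
  define c where "c = m * (m + 2) / 8"
  have mm: "0 \<le> m * (m + 2)" using m by simp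
  have t1: "1 \<le> t" using mm t by linarith
  have x: "1 \<le> x" using t1 m by (simp add: x_def ge_one_powr_ge_zero)
  have c: "0 \<le> c" "c \<le> t" using mm t by (simp_all add: c_def)
  have "t * 1 \<le> t * x" using x t1 by (intro mult_left_mono) auto
  then have "c \<le> t * x" using c by simp
  then have cxt: "c / (x * t) \<le> 1" using x t1 by (simp add: divide_le_eq mult.commute)
  have q: "wkb_log m t = - x - m / (2 * t) + c / (x * t\<^sup>2)"
    by (simp add: wkb_log_def x_def c_def)
  have cx: "c / (x * t\<^sup>2) \<le> 1"
  proof -
    have "c / (x * t\<^sup>2) = c / (x * t) / t" by (simp add: power2_eq_square)
    also have "\<dots> \<le> 1 / t" using cxt t1 by (intro divide_right_mono) auto
    also have "\<dots> \<le> 1" using t1 by simp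
    finally show ?thesis .
  qed
  have "0 \<le> m / (2 * t)" using m t1 by simp
  then show "wkb_log m t \<le> 0" using q cx x by linarith
  have "m / (2 * t) \<le> m * x"
  proof -
    have "m / (2 * t) \<le> m / 1" using m t1 by (intro divide_left_mono) auto
    also have "\<dots> \<le> m * x" using mult_left_mono[OF x m] by simp
    finally show ?thesis .
  qed
  moreover have "0 \<le> c / (x * t\<^sup>2)" using c x by simp
  ultimately show "- wkb_log m t \<le> (m + 1) * t powr m"
    using q by (simp add: x_def algebra_simps)
  have "wkb_log_deriv m t + (wkb_log m t)\<^sup>2 - x\<^sup>2 = c / (x * t ^ 3) * (c / (x * t) - (2 * m + 2))"
  proof -
    have q': "wkb_log_deriv m t = - m * x / t + m / (2 * t\<^sup>2) - c * (m + 2) / (x * t ^ 3)"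
      by (simp add: wkb_log_deriv_def x_def c_def)
    \<comment> \<open>This relation cancels the coefficient of t^(-2) in q' + q^2 - t^(2m); it is
      the origin of the constant \<open>m * (m + 2) / 8\<close>. Only terms with the favourable sign
      are left.\<close>
    have c': "m\<^sup>2 = 8 * c - 2 * m" by (simp add: c_def power2_eq_square algebra_simps)
    have "x \<noteq> 0" "t \<noteq> 0" using x t1 by auto
    then have "wkb_log_deriv m t + (wkb_log m t)\<^sup>2 - x\<^sup>2
      = (m / 2 + m\<^sup>2 / 4 - 2 * c) / t\<^sup>2 + c / (x * t ^ 3) * (c / (x * t) - (2 * m + 2))"
      unfolding q q' by (simp add: power2_eq_square power3_eq_cube field_simps)
    then show ?thesis unfolding c' by (simp add: field_simps)
  qed
  also have "\<dots> \<le> 0"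
  proof (rule mult_nonneg_nonpos)
    show "c / (x * t) - (2 * m + 2) \<le> 0" using cxt m by linarith
    show "0 \<le> c / (x * t ^ 3)" using c x t1 by simp
  qed
  finally show "wkb_log_deriv m t + (wkb_log m t)\<^sup>2 \<le> t powr (2 * m)"
    by (simp add: x_def power2_eq_square powr_add[symmetric])
qed

text \<open>The correction factor of \<open>wkb\<close> is at most 1, and the exponent
  \<open>1 - p\<close> is negative, so omitting it decreases the power.\<close>

lemma wkb_powr_lower_bound:
  assumes "0 < t" "0 \<le> m" "1 < p"
  shows "exp ((p - 1) * \<xi> m t) * t powr (m * (p - 1) / 2) \<le> wkb m t powr (1 - p)"
proof -
  define z where "z = m * (m + 2) / (8 * (m + 1)) / (t powr m * t)"
  have z: "0 \<le> z" using assms by (simp add: z_def)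
  have "exp ((p - 1) * \<xi> m t) * t powr (m * (p - 1) / 2) = exp ((p - 1) * (\<xi> m t + m / 2 * ln t))"
    using assms by (simp add: powr_def exp_add[symmetric] algebra_simps)
  also have "\<dots> \<le> exp ((p - 1) * (\<xi> m t + m / 2 * ln t + z))"
    using z assms by simp
  also have "\<dots> = wkb m t powr (1 - p)"
  proof -
    have "wkb m t = exp (- (\<xi> m t + m / 2 * ln t + z))" by (simp add: wkb_def z_def)
    then have "wkb m t powr (1 - p) = exp ((1 - p) * - (\<xi> m t + m / 2 * ln t + z))" by (simp add: powr_def)
    also have "(1 - p) * - y = (p - 1) * y" for y by (simp add: algebra_simps)
    finally show ?thesis by simp
  qed
  finally show ?thesis .
qed

text \<open>A positive \<open>L\<close> can satisfy an inequality L' \<ge> C P' L^p only while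
  \<open>P\<close> stays below an explicit bound. Keeping the primitive \<open>P\<close> abstract
  treats both regimes at once: it will be a power of \<open>t\<close> below the critical exponent
  and the logarithm at it.\<close>

lemma ode_lifespan:
  fixes X W W' P :: "real \<Rightarrow> real"
  assumes m: "0 \<le> m" and p: "1 < p" and c: "0 < c" and V\<^sub>0: "0 < V\<^sub>0"
    and a: "a = 1 + m * (m + 2)" "a \<le> \<tau>"
    and derX: "\<And>t. t \<in> {a..\<tau>} \<Longrightarrow> (X has_real_derivative W t) (at t within {a..\<tau>})"
    and derW: "\<And>t. t \<in> {a..\<tau>} \<Longrightarrow> (W has_real_derivative W' t) (at t within {a..\<tau>})"
    and ineq: "\<And>t. t \<in> {a..\<tau>} \<Longrightarrow>
      t powr (2 * m) * X t + c * exp (- (p - 1) * \<xi> m t) * t powr (- \<beta>) * W t powr p \<le> W' t"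
    and X: "\<And>t. t \<in> {a..\<tau>} \<Longrightarrow> 0 \<le> X t" and W: "\<And>t. t \<in> {a..\<tau>} \<Longrightarrow> V\<^sub>0 \<le> W t"
    and init: "X a = 0" "W a = V\<^sub>0"
    and P: "\<And>t. t \<in> {a..\<tau>} \<Longrightarrow> (P has_real_derivative t powr (m * (p - 1) / 2 - \<beta>)) (at t within {a..\<tau>})"
  shows "P \<tau> \<le> P a + wkb m a powr (1 - p) / ((p - 1) * c * (1 / (1 + (m + 1)\<^sup>2)) powr p) * V\<^sub>0 powr (1 - p)"
proof -
  define \<gamma> where "\<gamma> = (\<lambda>t. c * exp (- (p - 1) * \<xi> m t) * t powr (- \<beta>))"
  \<comment> \<open>With \<open>K = m + 1\<close> from the bound on \<open>- wkb_log\<close>, this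
    is the value satisfying \<open>\<delta> * (1 + K\<^sup>2) = 1\<close>, for which the terms in
    fact \<open>4\<close> of the comparison below cancel.\<close>
  define \<delta> where "\<delta> = 1 / (1 + (m + 1)\<^sup>2)"
  define K where "K = m + 1"
  have K: "1 \<le> K" using m by (simp add: K_def)
  have \<delta>: "0 < \<delta>" "\<delta> \<le> 1" "\<delta> * (1 + K\<^sup>2) = 1"
  proof -
    have "0 < 1 + (m + 1)\<^sup>2" using zero_le_power2[of "m + 1"] by linarith
    then show "0 < \<delta>" "\<delta> \<le> 1" "\<delta> * (1 + K\<^sup>2) = 1" by (simp_all add: \<delta>_def K_def)
  qed
  have t1: "1 \<le> t" if "t \<in> {a..\<tau>}" for t
  proof -
    have "0 \<le> m * (m + 2)" using m by simp
    then show ?thesis using that a by simp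
  qed
  have ta: "1 + m * (m + 2) \<le> t" if "t \<in> {a..\<tau>}" for t using that a by simp
  have \<gamma>pos: "0 < \<gamma> t" if "t \<in> {a..\<tau>}" for t using t1[OF that] c by (simp add: \<gamma>_def)
  have Wpos: "0 < W t" if "t \<in> {a..\<tau>}" for t using W[OF that] V\<^sub>0 by simp
  have \<rho>pos: "0 < wkb m t" for t by (simp add: wkb_def)
  have der\<rho>: "(wkb m has_real_derivative wkb_log m t * wkb m t) (at t within {a..\<tau>})" if "t \<in> {a..\<tau>}" for t
    by (rule has_field_derivative_at_within[OF wkb_has_derivative]) (use t1[OF that] m in auto)
  have derq: "(wkb_log m has_real_derivative wkb_log_deriv m t) (at t within {a..\<tau>})" if "t \<in> {a..\<tau>}" for t
    by (rule has_field_derivative_at_within[OF wkb_log_has_derivative]) (use t1[OF that] in auto)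
  have der\<xi>: "(\<xi> m has_real_derivative t powr m) (at t within {a..\<tau>})" if "t \<in> {a..\<tau>}" for t
    by (rule has_field_derivative_at_within[OF \<xi>_has_derivative]) (use t1[OF that] m in auto)
  have cW: "continuous_on {a..\<tau>} W" by (rule DERIV_continuous_on[OF derW])
  have c\<rho>: "continuous_on {a..\<tau>} (wkb m)" by (rule DERIV_continuous_on[OF der\<rho>])
  have c\<xi>: "continuous_on {a..\<tau>} (\<xi> m)" by (rule DERIV_continuous_on[OF der\<xi>])
  define F where "F = (\<lambda>t. wkb m t * (\<gamma> t * W t powr p))"
  have cF: "continuous_on {a..\<tau>} F"
    unfolding F_def \<gamma>_def
    by (intro continuous_intros cW c\<rho> c\<xi>) (use Wpos t1 in force)+
  have Fpos: "0 \<le> F t" if "t \<in> {a..\<tau>}" for t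
    using \<rho>pos[of t] \<gamma>pos[OF that] by (simp add: F_def)
  define L where "L = (\<lambda>t. wkb m a * V\<^sub>0 + integral {a..t} F)"
  have derL: "(L has_real_derivative F t) (at t within {a..\<tau>})" if "t \<in> {a..\<tau>}" for t
    unfolding L_def using integral_has_real_derivative[OF cF that] by (auto intro!: derivative_eq_intros)
  have La: "L a = wkb m a * V\<^sub>0" by (simp add: L_def)
  have Lpos: "0 < L t" if "t \<in> {a..\<tau>}" for t
  proof -
    have "L a \<le> L t" by (rule deriv_nonneg_mono[OF derL Fpos that])
    moreover have "0 < L a" using La \<rho>pos[of a] V\<^sub>0 by simp
    ultimately show ?thesis by simp
  qed
  have A: "L t / wkb m t \<le> W t - wkb_log m t * X t" if t: "t \<in> {a..\<tau>}" for t
  proof -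
    have "wkb m a * (W a - wkb_log m a * X a) - L a \<le> wkb m t * (W t - wkb_log m t * X t) - L t"
    proof (rule deriv_nonneg_mono[OF _ _ t])
      fix s assume s: "s \<in> {a..\<tau>}"
      show "((\<lambda>t. wkb m t * (W t - wkb_log m t * X t) - L t) has_real_derivative
         (wkb_log m s * wkb m s) * (W s - wkb_log m s * X s)
         + (W' s - (wkb_log_deriv m s * X s + W s * wkb_log m s)) * wkb m s - F s) (at s within {a..\<tau>})"
        using DERIV_diff[OF DERIV_mult[OF der\<rho>[OF s] DERIV_diff[OF derW[OF s] DERIV_mult[OF derq[OF s] derX[OF s]]]] derL[OF s]]
        by (simp add: mult_ac)
      \<comment> \<open>After factoring out \<open>wkb m s\<close>, the first bracket is nonnegative
        by the differential inequality and the second by the supersolution property together with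
        \<open>X s \<ge> 0\<close>.\<close>
      have "(wkb_log m s * wkb m s) * (W s - wkb_log m s * X s)
         + (W' s - (wkb_log_deriv m s * X s + W s * wkb_log m s)) * wkb m s - F s
         = wkb m s * ((W' s - s powr (2 * m) * X s - \<gamma> s * W s powr p)
            + (s powr (2 * m) - (wkb_log_deriv m s + (wkb_log m s)\<^sup>2)) * X s)"
        by (simp add: F_def power2_eq_square algebra_simps)
      also have "\<dots> \<ge> 0"
        using ineq[OF s] wkb_log_bounds(3)[OF m ta[OF s]] X[OF s] \<rho>pos[of s]
        by (intro mult_nonneg_nonneg add_nonneg_nonneg) (auto simp: \<gamma>_def)
      finally show "0 \<le> (wkb_log m s * wkb m s) * (W s - wkb_log m s * X s)
         + (W' s - (wkb_log_deriv m s * X s + W s * wkb_log m s)) * wkb m s - F s" .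
    qed
    then have "L t \<le> wkb m t * (W t - wkb_log m t * X t)" using La init by simp
    then show ?thesis using \<rho>pos[of t] by (simp add: field_simps)
  qed
  \<comment> \<open>The difference \<open>D\<close> of the two sides satisfies D' + (t^m / K) D
    \<ge> 0. As \<open>\<xi>\<close> is a primitive of t^m, exp (\<xi> / K) is an integrating
    factor, and \<open>D\<close> remains nonnegative if it is so at \<open>a\<close>.\<close>
  have D: "\<delta> * (L t / wkb m t) \<le> W t" if t: "t \<in> {a..\<tau>}" for t
  proof -
    define D where "D = (\<lambda>t. W t - \<delta> * (L t / wkb m t))"
    define D' where "D' = (\<lambda>s. W' s - \<delta> * (\<gamma> s * W s powr p - wkb_log m s * (L s / wkb m s)))"
    have derD: "(D has_real_derivative D' s) (at s within {a..\<tau>})" if s: "s \<in> {a..\<tau>}" for s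
    proof -
      have ne: "wkb m s \<noteq> 0" using \<rho>pos[of s] by simp
      have eq: "(F s * wkb m s - L s * (wkb_log m s * wkb m s)) / (wkb m s * wkb m s)
         = \<gamma> s * W s powr p - wkb_log m s * (L s / wkb m s)"
        using ne by (simp add: F_def field_simps)
      have "((\<lambda>t. L t / wkb m t) has_real_derivative \<gamma> s * W s powr p - wkb_log m s * (L s / wkb m s)) (at s within {a..\<tau>})"
        using DERIV_divide[OF derL[OF s] der\<rho>[OF s] ne] unfolding eq .
      from DERIV_diff[OF derW[OF s] DERIV_cmult[OF this, of \<delta>]] show ?thesis
        unfolding D_def D'_def .
    qed
    have "D a * exp (\<xi> m a / K) \<le> D t * exp (\<xi> m t / K)"
    proof (rule deriv_nonneg_mono[OF _ _ t])
      fix s assume s: "s \<in> {a..\<tau>}"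
      show "((\<lambda>t. D t * exp (\<xi> m t / K)) has_real_derivative
          exp (\<xi> m s / K) * (D' s + s powr m / K * D s)) (at s within {a..\<tau>})"
        using DERIV_mult[OF derD[OF s] DERIV_chain2[OF DERIV_exp DERIV_cdivide[OF der\<xi>[OF s], of K]]]
        by (simp add: algebra_simps)
      define x where "x = s powr m"
      define l where "l = L s / wkb m s"
      have x: "0 < x" using t1[OF s] by (simp add: x_def)
      have l: "0 < l" using Lpos[OF s] \<rho>pos[of s] by (simp add: l_def)
      have q: "wkb_log m s \<le> 0" "- wkb_log m s \<le> K * x"
        using wkb_log_bounds(1,2)[OF m ta[OF s]] by (simp_all add: x_def K_def)
      \<comment> \<open>By \<open>A\<close>, whatever \<open>W\<close> lacks compared with
        \<open>l\<close> must come from \<open>X\<close>; the linear term of the differential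
        inequality then feeds it back into \<open>W'\<close>.\<close>
      have "l - W s \<le> K * x * X s"
        using A[OF s] mult_right_mono[OF q(2) X[OF s]] by (simp add: l_def)
      then have "x / K * (l - W s) \<le> x / K * (K * x * X s)"
        using x K by (intro mult_left_mono) auto
      also have "\<dots> = s powr (2 * m) * X s"
        using K by (simp add: x_def powr_add[symmetric])
      finally have 1: "x / K * (l - W s) \<le> s powr (2 * m) * X s" .
      have 2: "\<delta> * (\<gamma> s * W s powr p) \<le> \<gamma> s * W s powr p"
        using \<delta> \<gamma>pos[OF s] by (intro mult_left_le_one_le) auto
      have 3: "- \<delta> * (K * x * l) \<le> \<delta> * (wkb_log m s * l)"
        using mult_left_mono[OF mult_right_mono[OF q(2), of l], of \<delta>] l \<delta> by simp
      have 4: "x / K * (l - W s) - \<delta> * (K * x * l) + x / K * (W s - \<delta> * l) = 0"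
      proof -
        have "x / K * (l - W s) - \<delta> * (K * x * l) + x / K * (W s - \<delta> * l) = x / K * l * (1 - \<delta> * (1 + K\<^sup>2))"
          using K by (simp add: field_simps power2_eq_square)
        then show ?thesis using \<delta>(3) by simp
      qed
      have "D' s = W' s - \<delta> * (\<gamma> s * W s powr p) + \<delta> * (wkb_log m s * l)"
        by (simp add: D'_def l_def right_diff_distrib)
      moreover have "D s = W s - \<delta> * l" by (simp add: D_def l_def)
      ultimately have "0 \<le> D' s + x / K * D s"
        using 1 2 3 4 ineq[OF s] unfolding \<gamma>_def by (simp only:)
      then show "0 \<le> exp (\<xi> m s / K) * (D' s + s powr m / K * D s)"
        by (simp add: x_def)
    qed
    moreover have "0 \<le> D a"
    proof -
      have "D a = V\<^sub>0 * (1 - \<delta>)" using La init \<rho>pos[of a] by (simp add: D_def algebra_simps)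
      then show ?thesis using V\<^sub>0 \<delta> by simp
    qed
    ultimately have "0 \<le> D t * exp (\<xi> m t / K)" by (meson exp_ge_zero mult_nonneg_nonneg order_trans)
    then have "0 \<le> D t" by (simp add: zero_le_mult_iff)
    then show ?thesis by (simp add: D_def)
  qed
  have growth: "c * \<delta> powr p * t powr (m * (p - 1) / 2 - \<beta>) * L t powr p \<le> F t" if t: "t \<in> {a..\<tau>}" for t
  proof -
    have tpos: "0 < t" using t1[OF t] by simp
    have e: "exp (- (p - 1) * \<xi> m t) * exp ((p - 1) * \<xi> m t) = 1"
      unfolding mult_exp_exp by (simp add: algebra_simps)
    have "t powr (m * (p - 1) / 2 - \<beta>) = (exp (- (p - 1) * \<xi> m t) * exp ((p - 1) * \<xi> m t)) * (t powr (- \<beta>) * t powr (m * (p - 1) / 2))"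
      unfolding e by (simp add: powr_add[symmetric])
    also have "\<dots> = exp (- (p - 1) * \<xi> m t) * t powr (- \<beta>) * (exp ((p - 1) * \<xi> m t) * t powr (m * (p - 1) / 2))"
      by (simp add: mult_ac)
    also have "\<dots> \<le> exp (- (p - 1) * \<xi> m t) * t powr (- \<beta>) * wkb m t powr (1 - p)"
      by (intro mult_left_mono wkb_powr_lower_bound tpos m p) auto
    finally have "c * \<delta> powr p * t powr (m * (p - 1) / 2 - \<beta>) * L t powr p
       \<le> c * \<delta> powr p * (exp (- (p - 1) * \<xi> m t) * t powr (- \<beta>) * wkb m t powr (1 - p)) * L t powr p"
      using c by (intro mult_right_mono mult_left_mono) auto
    also have "\<dots> = \<gamma> t * wkb m t * (\<delta> * (L t / wkb m t)) powr p"
      using \<rho>pos[of t] Lpos[OF t] \<delta>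
      by (simp add: \<gamma>_def powr_mult powr_divide powr_diff field_simps)
    also have "\<dots> \<le> \<gamma> t * wkb m t * W t powr p"
      using D[OF t] \<delta> Lpos[OF t] \<rho>pos[of t] \<gamma>pos[OF t] p
      by (intro mult_left_mono powr_mono2) auto
    finally show ?thesis by (simp add: F_def mult_ac)
  qed
  define C where "C = (p - 1) * c * \<delta> powr p"
  have C: "0 < C" using p c \<delta> by (simp add: C_def)
  \<comment> \<open>Bernoulli substitution: by \<open>growth\<close> the derivative of - L^(1-p) is
    at least \<open>C\<close> times that of \<open>P\<close>. The positive term L^(1-p) at
    \<open>\<tau>\<close> is discarded afterwards.\<close>
  have "- (L a powr (1 - p)) - C * P a \<le> - (L \<tau> powr (1 - p)) - C * P \<tau>"
  proof (rule deriv_nonneg_mono[where F = "\<lambda>t. - (L t powr (1 - p)) - C * P t"])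
    fix s assume s: "s \<in> {a..\<tau>}"
    have "((\<lambda>t. L t powr (1 - p)) has_real_derivative (1 - p) * L s powr (1 - p - 1) * F s) (at s within {a..\<tau>})"
      using DERIV_chain2[OF has_real_derivative_powr[OF Lpos[OF s]] derL[OF s]] .
    from DERIV_diff[OF DERIV_minus[OF this] DERIV_cmult[OF P[OF s], of C]]
    show "((\<lambda>t. - (L t powr (1 - p)) - C * P t) has_real_derivative
        (p - 1) * L s powr (- p) * F s - C * s powr (m * (p - 1) / 2 - \<beta>)) (at s within {a..\<tau>})"
      by (simp add: algebra_simps)
    have "C * s powr (m * (p - 1) / 2 - \<beta>) = (p - 1) * L s powr (- p) * (c * \<delta> powr p * s powr (m * (p - 1) / 2 - \<beta>) * L s powr p)"
      using Lpos[OF s] by (simp add: C_def powr_minus field_simps)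
    also have "\<dots> \<le> (p - 1) * L s powr (- p) * F s"
      using p by (intro mult_left_mono growth s) auto
    finally show "0 \<le> (p - 1) * L s powr (- p) * F s - C * s powr (m * (p - 1) / 2 - \<beta>)" by simp
  qed (use a in auto)
  then have "C * P \<tau> \<le> C * P a + L a powr (1 - p)"
    using powr_ge_zero[of "L \<tau>" "1 - p"] by linarith
  then have "P \<tau> \<le> P a + L a powr (1 - p) / C"
    using C by (simp add: field_simps)
  also have "L a powr (1 - p) = wkb m a powr (1 - p) * V\<^sub>0 powr (1 - p)"
    using La \<rho>pos[of a] V\<^sub>0 by (simp add: powr_mult)
  finally show ?thesis by (simp add: C_def \<delta>_def)
qed

section \<open>The lifespan estimate\<close>

text \<open>For \<open>s \<ge> 1\<close> the radius \<open>\<xi> m s + R\<close> is at most (1 + R)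
  s^(m+1), which turns the square roots into a power of \<open>s\<close>. The factor
  \<open>exp (\<xi> m s)\<close> is kept exact because it has to cancel against
  \<open>wkb\<close>.\<close>

lemma ball_bound_growth:
  assumes m: "0 \<le> m" and R: "0 < R" and s: "1 \<le> s" and N: "1 \<le> N"
  shows "ball_bound N (\<xi> m s + R)
    \<le> 2 * exp R * sqrt (4 * pi * (1 + R)) ^ (N - 1) * exp (\<xi> m s) * s powr ((m + 1) * (real N - 1) / 2)"
proof -
  have x: "1 \<le> s powr (m + 1)" using m s by (simp add: ge_one_powr_ge_zero)
  have "\<xi> m s \<le> s powr (m + 1) / 1"
    unfolding \<xi>_def using m by (intro divide_left_mono) auto
  moreover have "R * 1 \<le> R * s powr (m + 1)" using x R by (intro mult_left_mono) auto
  ultimately have r: "\<xi> m s + R \<le> (1 + R) * s powr (m + 1)" by (simp add: algebra_simps)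
  have "4 * pi * (\<xi> m s + R) \<le> 4 * pi * ((1 + R) * s powr (m + 1))"
    by (rule mult_left_mono[OF r]) simp
  then have "sqrt (4 * pi * (\<xi> m s + R)) \<le> sqrt (4 * pi * ((1 + R) * s powr (m + 1)))" by simp
  also have "\<dots> = sqrt (4 * pi * (1 + R)) * s powr ((m + 1) / 2)"
    using s by (simp add: real_sqrt_mult powr_half_sqrt[symmetric] powr_powr)
  finally have "sqrt (4 * pi * (\<xi> m s + R)) ^ (N - 1)
      \<le> (sqrt (4 * pi * (1 + R)) * s powr ((m + 1) / 2)) ^ (N - 1)"
    using \<xi>_nonneg[OF m, of s] R by (intro power_mono) auto
  also have "\<dots> = sqrt (4 * pi * (1 + R)) ^ (N - 1) * s powr ((m + 1) * (real N - 1) / 2)"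
  proof -
    have "(s powr ((m + 1) / 2)) ^ (N - 1) = (s powr ((m + 1) / 2)) powr real (N - 1)"
      using s by (subst powr_realpow) auto
    then show ?thesis using N by (simp add: power_mult_distrib powr_powr of_nat_diff)
  qed
  finally have "2 * exp (\<xi> m s + R) * sqrt (4 * pi * (\<xi> m s + R)) ^ (N - 1)
      \<le> 2 * exp (\<xi> m s + R) * (sqrt (4 * pi * (1 + R)) ^ (N - 1) * s powr ((m + 1) * (real N - 1) / 2))"
    by (rule mult_left_mono) simp
  then show ?thesis by (simp add: ball_bound_def exp_add mult_ac)
qed

text \<open>A vanishing integral would make the nonempty open set on which \<open>g\<close> is
  nonzero a null set.\<close>

lemma integral_exp_pos:
  fixes g :: "real^'n \<Rightarrow> real"
  assumes g: "test_function g" "supp g \<subseteq> ball 0 R" "\<And>x. 0 \<le> g x" "g z \<noteq> 0" and R: "0 < R"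
  shows "0 < (LINT x|lborel. g x * exp (x $ k))"
proof -
  have eq: "g x * exp_cutoff k R x = g x * exp (x $ k)" for x
  proof (cases "x \<in> ball 0 R")
    case False
    then have "g x = 0" using g(2) by (intro not_in_supp) blast
    then show ?thesis by simp
  qed (simp add: exp_cutoff_eq)
  have "integrable lborel (\<lambda>x. g x * exp_cutoff k R x)"
    using R by (intro L2_mult_integrable test_function_L2 g(1) test_function_exp_cutoff) simp
  then have int: "integrable lborel (\<lambda>x. g x * exp (x $ k))" unfolding eq .
  have "(LINT x|lborel. g x * exp (x $ k)) \<noteq> 0"
  proof
    assume "(LINT x|lborel. g x * exp (x $ k)) = 0"
    then have "AE x in lborel. g x * exp (x $ k) = 0"
      using integral_nonneg_eq_0_iff_AE[OF int] g(3) by simp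
    then have ae: "AE x in lborel. x \<notin> {x. g x \<noteq> 0}" by simp
    have "continuous_on UNIV g" using g(1) smooth_continuous by (auto simp: test_function_def)
    then have op: "open {x. g x \<noteq> 0}"
      by (intro open_Collect_neq continuous_on_const)
    then have "{x. g x \<noteq> 0} \<in> null_sets lborel"
      using ae by (subst AE_iff_null_sets) auto
    then have "negligible {x. g x \<noteq> 0}"
      by (simp add: negligible_iff_null_sets null_sets_completionI)
    then show False using open_not_negligible[OF op] g(4) by blast
  qed
  moreover have "0 \<le> (LINT x|lborel. g x * exp (x $ k))"
    using g(3) by (intro Bochner_Integration.integral_nonneg) simp
  ultimately show ?thesis by simp
qed

text \<open>\<open>B\<close> is chosen before \<open>\<epsilon>\<close>, \<open>T\<close> and
  \<open>u\<close>, which yields the constant independent of \<open>\<epsilon>\<close>. The power of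
  \<open>\<epsilon>\<close> stems from the initial moment, which is proportional to
  \<open>\<epsilon>\<close>.\<close>

lemma lifespan_integral_bound:
  fixes f g :: "real^'n \<Rightarrow> real" and m R p :: real
  assumes m: "m \<ge> 0" and R: "R > 0" and p: "p > 1"
    and f: "test_function f" "supp f \<subseteq> ball 0 R" "\<And>x. 0 \<le> f x"
    and g: "test_function g" "supp g \<subseteq> ball 0 R" "\<And>x. 0 \<le> g x" "g z \<noteq> 0"
  defines "a \<equiv> 1 + m * (m + 2)" and "b \<equiv> ((m + 1) * (real CARD('n) - 1) - m) * (p - 1) / 2"
  shows "\<exists>B>0. \<forall>\<epsilon> T u P \<tau>. 0 < \<epsilon> \<longrightarrow> energy_solution m p \<epsilon> f g T u \<longrightarrow>
      ess_supp (UNIV \<times> time_interval T) u \<subseteq> {(x, t). 0 \<le> t \<and> norm x \<le> \<xi> m t + R} \<longrightarrow>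
      a \<le> \<tau> \<longrightarrow> ereal \<tau> < T \<longrightarrow> (\<forall>t>0. (P has_real_derivative t powr (- b)) (at t)) \<longrightarrow>
      P \<tau> \<le> P a + B * \<epsilon> powr (1 - p)"
proof -
  \<comment> \<open>Any coordinate direction serves.\<close>
  define k :: 'n where "k = undefined"
  define N where "N = CARD('n)"
  have N: "1 \<le> N" using zero_less_card_finite[where 'a='n] by (simp add: N_def)
  have a1: "1 \<le> a" using m by (simp add: a_def)
  define g0 where "g0 = (LINT x|lborel. g x * exp (x $ k))"
  have g0: "0 < g0" unfolding g0_def by (rule integral_exp_pos[OF g R])
  have f0: "0 \<le> (LINT x|lborel. f x * exp (x $ k))"
    using f(3) by (intro Bochner_Integration.integral_nonneg) simp
  define K where "K = 2 * exp R * sqrt (4 * pi * (1 + R)) ^ (N - 1)"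
  have K: "0 < K" using R by (simp add: K_def)
  define c where "c = K powr (1 - p)"
  have c: "0 < c" using K by (simp add: c_def)
  \<comment> \<open>The exponent of \<open>s\<close> in \<open>ball_bound_growth\<close>, multiplied
    by the Hoelder power \<open>p - 1\<close>.\<close>
  define \<beta> where "\<beta> = (m + 1) * (real N - 1) / 2 * (p - 1)"
  define \<gamma> where "\<gamma> = (\<lambda>t. c * exp (- (p - 1) * \<xi> m t) * t powr (- \<beta>))"
  define B0 where "B0 = wkb m a powr (1 - p) / ((p - 1) * c * (1 / (1 + (m + 1)\<^sup>2)) powr p)"
  have wkb: "0 < wkb m a" by (simp add: wkb_def)
  have B0: "0 < B0"
  proof -
    have "0 < 1 + (m + 1)\<^sup>2" using zero_le_power2[of "m + 1"] by linarith
    then show ?thesis using p c wkb by (simp add: B0_def)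
  qed
  have b: "m * (p - 1) / 2 - \<beta> = - b" by (simp add: b_def \<beta>_def N_def field_simps)
  have \<gamma>_le: "\<gamma> s * y powr p \<le> max y 0 powr p / ball_bound N (\<xi> m s + R) powr (p - 1)" if s: "1 \<le> s" and y: "0 < y" for s y
  proof -
    have pos: "0 < ball_bound N (\<xi> m s + R)"
      using \<xi>_nonneg[OF m, of s] R by (intro ball_bound_pos) simp
    have "ball_bound N (\<xi> m s + R) powr (p - 1) \<le> (K * exp (\<xi> m s) * s powr ((m + 1) * (real N - 1) / 2)) powr (p - 1)"
      using ball_bound_growth[OF m R s N] pos p by (intro powr_mono2) (auto simp: K_def)
    also have "\<dots> = K powr (p - 1) * exp ((p - 1) * \<xi> m s) * s powr \<beta>"
    proof -
      have "exp (\<xi> m s) powr (p - 1) = exp ((p - 1) * \<xi> m s)" by (simp add: powr_def)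
      then show ?thesis using K s by (simp add: powr_mult powr_powr \<beta>_def)
    qed
    finally have le: "ball_bound N (\<xi> m s + R) powr (p - 1) \<le> K powr (p - 1) * exp ((p - 1) * \<xi> m s) * s powr \<beta>" .
    have "\<gamma> s = 1 / (K powr (p - 1) * exp ((p - 1) * \<xi> m s) * s powr \<beta>)"
    proof -
      have "c = 1 / K powr (p - 1)" using K powr_minus_divide[of K "p - 1"] by (simp add: c_def)
      moreover have "exp (- (p - 1) * \<xi> m s) = 1 / exp ((p - 1) * \<xi> m s)"
        unfolding mult_minus_left exp_minus inverse_eq_divide ..
      moreover have "s powr (- \<beta>) = 1 / s powr \<beta>" by (rule powr_minus_divide)
      ultimately show ?thesis by (simp add: \<gamma>_def)
    qed
    also have "\<dots> \<le> 1 / ball_bound N (\<xi> m s + R) powr (p - 1)"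
      using le pos K s by (intro divide_left_mono) auto
    finally have "\<gamma> s * y powr p \<le> 1 / ball_bound N (\<xi> m s + R) powr (p - 1) * y powr p"
      by (rule mult_right_mono) simp
    then show ?thesis using y by simp
  qed
  show ?thesis
  proof (intro exI[of _ "B0 * g0 powr (1 - p)"] conjI allI impI)
    show "0 < B0 * g0 powr (1 - p)" using B0 g0 by simp
    fix \<epsilon> T u P \<tau>
    assume \<epsilon>: "0 < \<epsilon>" and sol: "energy_solution m p \<epsilon> f g T u"
      and supp: "ess_supp (UNIV \<times> time_interval T) u \<subseteq> {(x, t). 0 \<le> t \<and> norm x \<le> \<xi> m t + R}"
      and \<tau>: "a \<le> \<tau>" "ereal \<tau> < T"
      and P: "\<forall>t>0. (P has_real_derivative t powr (- b)) (at t)"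
    have \<tau>a: "a \<le> \<tau>" "0 \<le> \<tau>" using \<tau> a1 by simp_all
    define V\<^sub>0 where "V\<^sub>0 = \<epsilon> * g0"
    have V\<^sub>0: "0 < V\<^sub>0" using \<epsilon> g0 by (simp add: V\<^sub>0_def)
    define M where "M = (\<lambda>s. ball_bound N (\<xi> m s + R) powr (p - 1))"
    obtain U V where UV:
      "\<And>t. t \<in> {0..\<tau>} \<Longrightarrow> (U has_real_derivative V t) (at t within {0..\<tau>})"
      "continuous_on {0..\<tau>} V"
      "U 0 = \<epsilon> * (LINT x|lborel. f x * exp (x $ k))" "V 0 = V\<^sub>0"
      "\<And>t. t \<in> {0..\<tau>} \<Longrightarrow> (\<lambda>s. s powr (2 * m) * U s + max (V s) 0 powr p / M s) integrable_on {0..t}"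
      "\<And>t. t \<in> {0..\<tau>} \<Longrightarrow> V 0 + integral {0..t} (\<lambda>s. s powr (2 * m) * U s + max (V s) 0 powr p / M s) \<le> V t"
      using energy_solution_moments[OF m R p f(1,2) g(1,2) sol supp \<tau>a(2) \<tau>(2), of k thesis]
      unfolding V\<^sub>0_def g0_def M_def N_def by blast
    have U0: "0 \<le> U 0" using UV(3) f0 \<epsilon> by simp
    have n: "0 \<le> max (V s) 0 powr p / M s" for s by (simp add: M_def)
    have cont_\<gamma>: "continuous_on {a..\<tau>} \<gamma>"
    proof -
      have "continuous_on {a..\<tau>} (\<xi> m)"
        by (rule continuous_on_subset[OF continuous_on_\<xi>[OF m]]) (use a1 in auto)
      then show ?thesis
        unfolding \<gamma>_def using a1 by (auto intro!: continuous_intros)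
    qed
    have \<gamma>_nonneg: "0 \<le> \<gamma> s" if "s \<in> {a..\<tau>}" for s
      using c by (simp add: \<gamma>_def)
    have \<gamma>_n: "\<gamma> s * V s powr p \<le> max (V s) 0 powr p / M s" if "s \<in> {a..\<tau>}" "0 < V s" for s
      unfolding M_def by (rule \<gamma>_le) (use that a1 in auto)
    have a0: "0 < a" using a1 by simp
    obtain X W W' where XW:
      "\<And>t. t \<in> {a..\<tau>} \<Longrightarrow> (X has_real_derivative W t) (at t within {a..\<tau>})"
      "\<And>t. t \<in> {a..\<tau>} \<Longrightarrow> (W has_real_derivative W' t) (at t within {a..\<tau>})"
      "\<And>t. t \<in> {a..\<tau>} \<Longrightarrow> t powr (2 * m) * X t + \<gamma> t * W t powr p \<le> W' t"
      "\<And>t. t \<in> {a..\<tau>} \<Longrightarrow> 0 \<le> X t" "\<And>t. t \<in> {a..\<tau>} \<Longrightarrow> V\<^sub>0 \<le> W t" "X a = 0" "W a = V\<^sub>0"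
      by (rule moments_C1_minorant[OF UV(1,2) U0 V\<^sub>0 n UV(5) UV(6)[unfolded UV(4)] a0 \<tau>a(1) p cont_\<gamma> \<gamma>_nonneg \<gamma>_n]; assumption?) blast
    have "P \<tau> \<le> P a + B0 * V\<^sub>0 powr (1 - p)"
      unfolding B0_def
    proof (rule ode_lifespan[OF m p c V\<^sub>0 a_def[THEN meta_eq_to_obj_eq] \<tau>a(1) XW(1,2) _ XW(4-7)])
      show "t powr (2 * m) * X t + c * exp (- (p - 1) * \<xi> m t) * t powr (- \<beta>) * W t powr p \<le> W' t"
        if "t \<in> {a..\<tau>}" for t
        using XW(3)[OF that] by (simp add: \<gamma>_def)
      show "(P has_real_derivative t powr (m * (p - 1) / 2 - \<beta>)) (at t within {a..\<tau>})" if "t \<in> {a..\<tau>}" for t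
        unfolding b by (rule has_field_derivative_at_within) (use that a1 P in auto)
    qed
    also have "V\<^sub>0 powr (1 - p) = \<epsilon> powr (1 - p) * g0 powr (1 - p)"
      using \<epsilon> g0 by (simp add: V\<^sub>0_def powr_mult)
    finally show "P \<tau> \<le> P a + B0 * g0 powr (1 - p) * \<epsilon> powr (1 - p)"
      by (simp add: mult_ac)
  qed
qed

text \<open>The threshold 1 for \<open>\<epsilon>\<close> works in every case: then
  \<open>\<epsilon> powr (1 - p) \<ge> 1\<close>, so the additive constant \<open>P a\<close> can be
  absorbed into \<open>C\<close>. Above the critical exponent both implications are vacuous.\<close>

theorem theorem2p3:
  fixes f g :: "real^'n \<Rightarrow> real" and m R p :: real
  assumes "m \<ge> 0" and "R > 0" and "p > 1"
    and "test_function f" and "test_function g"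
    and "supp f \<subseteq> ball 0 R" and "supp g \<subseteq> ball 0 R"
    and "\<forall>x. f x \<ge> 0" and "\<forall>x. g x \<ge> 0"
    and "\<exists>x. f x \<noteq> 0" and "\<exists>x. g x \<noteq> 0"
  shows "\<exists>\<epsilon>\<^sub>0>0. \<exists>C>0. \<forall>\<epsilon> T u.
    0 < \<epsilon> \<longrightarrow> \<epsilon> \<le> \<epsilon>\<^sub>0 \<longrightarrow>
    energy_solution m p \<epsilon> f g T u \<longrightarrow>
    ess_supp (UNIV \<times> time_interval T) u \<subseteq> {(x, t). 0 \<le> t \<and> norm x \<le> \<xi> m t + R} \<longrightarrow>
      (ereal p < p_tr CARD('n) m \<longrightarrow>
         T \<le> ereal (C * \<epsilon> powr
               (- (2 * (p - 1) / (2 - ((m + 1) * (real CARD('n) - 1) - m) * (p - 1)))))) \<and>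
      (ereal p = p_tr CARD('n) m \<longrightarrow>
         T \<le> ereal (exp (C * \<epsilon> powr (- (p - 1)))))"
proof -
  define d where "d = (m + 1) * (real CARD('n) - 1) - m"
  define b where "b = d * (p - 1) / 2"
  define a where "a = 1 + m * (m + 2)"
  have a: "1 \<le> a" using assms(1) by (simp add: a_def)
  obtain z where z: "g z \<noteq> 0" using assms(11) by blast
  have "\<exists>B>0. \<forall>\<epsilon> T u P \<tau>. 0 < \<epsilon> \<longrightarrow> energy_solution m p \<epsilon> f g T u \<longrightarrow>
      ess_supp (UNIV \<times> time_interval T) u \<subseteq> {(x, t). 0 \<le> t \<and> norm x \<le> \<xi> m t + R} \<longrightarrow>
      a \<le> \<tau> \<longrightarrow> ereal \<tau> < T \<longrightarrow> (\<forall>t>0. (P has_real_derivative t powr (- b)) (at t)) \<longrightarrow>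
      P \<tau> \<le> P a + B * \<epsilon> powr (1 - p)"
    unfolding a_def b_def d_def
    by (rule lifespan_integral_bound) (use assms z in auto)
  then obtain B where B: "0 < B" and bound:
    "\<And>\<epsilon> T u P \<tau>. 0 < \<epsilon> \<Longrightarrow> energy_solution m p \<epsilon> f g T u \<Longrightarrow>
      ess_supp (UNIV \<times> time_interval T) u \<subseteq> {(x, t). 0 \<le> t \<and> norm x \<le> \<xi> m t + R} \<Longrightarrow>
      a \<le> \<tau> \<Longrightarrow> ereal \<tau> < T \<Longrightarrow> \<forall>t>0. (P has_real_derivative t powr (- b)) (at t) \<Longrightarrow>
      P \<tau> \<le> P a + B * \<epsilon> powr (1 - p)"
    by blast
  \<comment> \<open>Times \<open>\<tau>\<close> strictly below \<open>T\<close> are excluded one by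
    one; this covers \<open>T = \<infinity>\<close>.\<close>
  have T_le: "T \<le> ereal E" if "\<And>\<tau>. E < \<tau> \<Longrightarrow> ereal \<tau> < T \<Longrightarrow> False" for T E
  proof (rule ccontr)
    assume "\<not> T \<le> ereal E"
    then have "ereal E < T" by simp
    from ereal_dense2[OF this] obtain \<tau> where "ereal E < ereal \<tau>" "ereal \<tau> < T" by blast
    then show False using that[of \<tau>] by simp
  qed
  have \<epsilon>_ge: "1 \<le> \<epsilon> powr (1 - p)" if "0 < \<epsilon>" "\<epsilon> \<le> 1" for \<epsilon>
    using powr_mono'[of "1 - p" 0 \<epsilon>] that assms(3) by simp
  consider "ereal p < p_tr CARD('n) m" | "ereal p = p_tr CARD('n) m" | "ereal p > p_tr CARD('n) m"
    using less_linear by blast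
  then show ?thesis
  proof cases
    case 1
    have b1: "b < 1"
    proof (cases "d > 0")
      case True
      then have "p < 1 + 2 / d" using 1 by (simp add: p_tr_def d_def Let_def)
      then show ?thesis using True by (simp add: b_def field_simps)
    next
      case False
      then have "d * (p - 1) \<le> 0" using assms(3) by (intro mult_nonpos_nonneg) auto
      then show ?thesis by (simp add: b_def)
    qed
    \<comment> \<open>The integral bound becomes
      \<open>\<tau> powr (1 - b) \<le> Q * \<epsilon> powr (1 - p)\<close>. The first summand also
      guarantees that a time beyond the claimed lifespan exceeds \<open>a\<close>, where that bound
      starts to be available.\<close>
    define Q where "Q = a powr (1 - b) + (1 - b) * B"
    have Q: "a powr (1 - b) \<le> Q" "0 < Q" using a b1 B by (simp_all add: Q_def add_pos_pos)
    define C where "C = Q powr (1 / (1 - b))"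
    have C: "0 < C" using Q by (simp add: C_def)
    have e: "2 * (p - 1) / (2 - d * (p - 1)) = (p - 1) / (1 - b)"
    proof -
      have "2 - d * (p - 1) = 2 * (1 - b)" by (simp add: b_def)
      then show ?thesis by (simp only:) (rule mult_divide_mult_cancel_left, simp)
    qed
    have Ce: "(Q * \<epsilon> powr (1 - p)) powr (1 / (1 - b)) = C * \<epsilon> powr (- (2 * (p - 1) / (2 - d * (p - 1))))"
      if "0 < \<epsilon>" for \<epsilon>
    proof -
      have "- ((p - 1) / (1 - b)) = (1 - p) * (1 / (1 - b))"
        unfolding minus_divide_left by simp
      then show ?thesis unfolding e using Q that by (simp add: C_def powr_mult powr_powr)
    qed
    have main: "T \<le> ereal (C * \<epsilon> powr (- (2 * (p - 1) / (2 - d * (p - 1)))))"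
      if \<epsilon>: "0 < \<epsilon>" "\<epsilon> \<le> 1" and sol: "energy_solution m p \<epsilon> f g T u"
        and supp: "ess_supp (UNIV \<times> time_interval T) u \<subseteq> {(x, t). 0 \<le> t \<and> norm x \<le> \<xi> m t + R}" for \<epsilon> T u
    proof (rule T_le)
      fix \<tau>
      assume "C * \<epsilon> powr (- (2 * (p - 1) / (2 - d * (p - 1)))) < \<tau>" and \<tau>T: "ereal \<tau> < T"
      then have less: "(Q * \<epsilon> powr (1 - p)) powr (1 / (1 - b)) < \<tau>" by (simp add: Ce[OF \<epsilon>(1)])
      have "((Q * \<epsilon> powr (1 - p)) powr (1 / (1 - b))) powr (1 - b) < \<tau> powr (1 - b)"
        using less b1 by (intro powr_less_mono2) auto
      then have lt: "Q * \<epsilon> powr (1 - p) < \<tau> powr (1 - b)"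
        using b1 Q \<epsilon> by (simp add: powr_powr)
      have "a powr (1 - b) * 1 \<le> Q * \<epsilon> powr (1 - p)"
        using Q \<epsilon>_ge[OF \<epsilon>] by (intro mult_mono) auto
      then have "a powr (1 - b) < \<tau> powr (1 - b)" using lt by simp
      moreover have "0 \<le> \<tau>" using less powr_ge_zero[of "Q * \<epsilon> powr (1 - p)" "1 / (1 - b)"] by linarith
      ultimately have "a \<le> \<tau>"
        using powr_mono2[of "1 - b" \<tau> a] b1 a by (cases "a \<le> \<tau>") auto
      have "\<tau> powr (1 - b) / (1 - b) \<le> a powr (1 - b) / (1 - b) + B * \<epsilon> powr (1 - p)"
      proof (rule bound[OF \<epsilon>(1) sol supp \<open>a \<le> \<tau>\<close> \<tau>T])
        have "((\<lambda>t. t powr (1 - b) / (1 - b)) has_real_derivative t powr (- b)) (at t)" if "0 < t" for t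
          using DERIV_cdivide[OF has_real_derivative_powr[OF that, of "1 - b"], of "1 - b"] b1 by simp
        then show "\<forall>t>0. ((\<lambda>t. t powr (1 - b) / (1 - b)) has_real_derivative t powr (- b)) (at t)" by blast
      qed
      from mult_left_mono[OF this, of "1 - b"]
      have "\<tau> powr (1 - b) \<le> a powr (1 - b) + (1 - b) * B * \<epsilon> powr (1 - p)"
        using b1 by (simp add: distrib_left mult.assoc)
      also have "\<dots> \<le> a powr (1 - b) * \<epsilon> powr (1 - p) + (1 - b) * B * \<epsilon> powr (1 - p)"
        using mult_left_mono[OF \<epsilon>_ge[OF \<epsilon>], of "a powr (1 - b)"] by simp
      also have "\<dots> = Q * \<epsilon> powr (1 - p)" by (simp add: Q_def algebra_simps)
      finally show False using lt by simp
    qed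
    show ?thesis
      by (rule exI[of _ 1], simp, rule exI[of _ C]) (use main C 1 in \<open>auto simp: d_def\<close>)
  next
    case 2
    have d: "d > 0"
    proof (rule ccontr)
      assume "\<not> d > 0"
      then show False using 2 by (simp add: p_tr_def d_def Let_def)
    qed
    then have "p = 1 + 2 / d" using 2 by (simp add: p_tr_def d_def Let_def)
    then have b1: "b = 1" using d by (simp add: b_def)
    \<comment> \<open>The primitive is now \<open>ln\<close>, and \<open>ln a\<close> plays the same
      double role as \<open>a powr (1 - b)\<close> in the subcritical case.\<close>
    define C where "C = ln a + B"
    have C: "0 < C" using a B by (simp add: C_def add_nonneg_pos)
    have main: "T \<le> ereal (exp (C * \<epsilon> powr (- (p - 1))))"
      if \<epsilon>: "0 < \<epsilon>" "\<epsilon> \<le> 1" and sol: "energy_solution m p \<epsilon> f g T u"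
        and supp: "ess_supp (UNIV \<times> time_interval T) u \<subseteq> {(x, t). 0 \<le> t \<and> norm x \<le> \<xi> m t + R}" for \<epsilon> T u
    proof (rule T_le)
      fix \<tau>
      assume less: "exp (C * \<epsilon> powr (- (p - 1))) < \<tau>" and \<tau>T: "ereal \<tau> < T"
      have \<tau>0: "0 < \<tau>" using less exp_gt_zero[of "C * \<epsilon> powr (- (p - 1))"] by linarith
      have lt: "C * \<epsilon> powr (1 - p) < ln \<tau>"
      proof -
        have "ln (exp (C * \<epsilon> powr (- (p - 1)))) < ln \<tau>"
          using less \<tau>0 by (subst ln_less_cancel_iff) auto
        then show ?thesis by simp
      qed
      have "ln a * 1 \<le> C * \<epsilon> powr (1 - p)"
        using a B C \<epsilon>_ge[OF \<epsilon>] by (intro mult_mono) (auto simp: C_def)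
      then have "ln a \<le> ln \<tau>" using lt by simp
      then have "a \<le> \<tau>" using \<tau>0 a by (subst (asm) ln_le_cancel_iff) auto
      have "ln \<tau> \<le> ln a + B * \<epsilon> powr (1 - p)"
      proof (rule bound[OF \<epsilon>(1) sol supp \<open>a \<le> \<tau>\<close> \<tau>T])
        have "(ln has_real_derivative t powr (- b)) (at t)" if "0 < t" for t
          using DERIV_ln[OF that] that by (simp add: b1 powr_minus)
        then show "\<forall>t>0. (ln has_real_derivative t powr (- b)) (at t)" by blast
      qed
      also have "\<dots> \<le> ln a * \<epsilon> powr (1 - p) + B * \<epsilon> powr (1 - p)"
        using mult_left_mono[OF \<epsilon>_ge[OF \<epsilon>], of "ln a"] a by simp
      also have "\<dots> = C * \<epsilon> powr (1 - p)" by (simp add: C_def algebra_simps)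
      finally show False using lt by simp
    qed
    show ?thesis
      by (rule exI[of _ 1], simp, rule exI[of _ C]) (use main C 2 in auto)
  next
    case 3
    show ?thesis
      by (rule exI[of _ 1], simp, rule exI[of _ 1]) (use 3 in auto)
  qed
qed

end
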